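(* Let $\lambda=s^4$, $s=\sigma+it\in\mathbb{C}$. Then for $k=0,1,2,3$ the following asymptotic formulae hold as $|\lambda|\to\infty$, each uniformly in $x$ ($x\in[-1,0)$ for $\phi_{11},\phi_{21}$ and $x\in(0,1]$ for $\phi_{12},\phi_{22}$): $$\frac{d^k}{dx^k}\phi_{11}(x,\lambda)=O\left(|s|^{k-1}e^{|s|\frac{x+1}{a_1}}\right),$$ $$\frac{d^k}{dx^k}\phi_{12}(x,\lambda)=\frac{a_2^2s^2\delta_1\phi_{11}'(0)}{2}\frac{d^k}{dx^k}\cos\frac{sx}{a_2}+\frac{a_2^3s\delta_2\phi_{11}(0)}{2}\frac{d^k}{dx^k}\sin\frac{sx}{a_2}-\frac{a_2^2s^2\delta_1\phi_{11}'(0)}{4}\frac{d^k}{dx^k}\left(e^{\frac{sx}{a_2}}+e^{-\frac{sx}{a_2}}\right)-\frac{a_2^3s\delta_2\phi_{11}(0)}{4}\frac{d^k}{dx^k}\left(e^{\frac{sx}{a_2}}-e^{-\frac{sx}{a_2}}\right)+O\left(|s|^{k}e^{|s|\frac{a_1x+a_2}{a_1a_2}}\right),$$ $$\frac{d^k}{dx^k}\phi_{21}(x,\lambda)=\frac{\beta_2a_1}{2s}\frac{d^k}{dx^k}\sin\frac{s(x+1)}{a_1}+\frac{\beta_2a_1}{4s}\frac{d^k}{dx^k}\left(e^{\frac{s(x+1)}{a_1}}-e^{-\frac{s(x+1)}{a_1}}\right)+O\left(|s|^{k-2}e^{|s|\frac{x+1}{a_1}}\right),$$ $$\frac{d^k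}{dx^k}\phi_{22}(x,\lambda)=\frac{a_2^2s^2\delta_1\phi_{21}'(0)}{2}\frac{d^k}{dx^k}\cos\frac{sx}{a_2}+\frac{a_2^3s\delta_2\phi_{21}(0)}{2}\frac{d^k}{dx^k}\sin\frac{sx}{a_2}-\frac{a_2^2s^2\delta_1\phi_{21}'(0)}{4}\frac{d^k}{dx^k}\left(e^{\frac{sx}{a_2}}+e^{-\frac{sx}{a_2}}\right)-\frac{a_2^3s\delta_2\phi_{21}(0)}{4}\frac{d^k}{dx^k}\left(e^{\frac{sx}{a_2}}-e^{-\frac{sx}{a_2}}\right)+O\left(|s|^{k-1}e^{|s|\frac{a_1x+a_2}{a_1a_2}}\right).$$
   Context: Let $I=[-1,0)\cup(0,1]$. Let $a(x)=a_1^4$ for $x\in[-1,0)$ and $a(x)=a_2^4$ for $x\in(0,1]$, where $a_1,a_2>0$ are given real numbers. Let $q$ be a real-valued function continuous on $[-1,0)\cup(0,1]$ with finite limits $q(0\pm)=\lim_{x\to0\pm}q(x)$. Let $\beta_1,\beta_2,\delta_1,\delta_2$ be real with $|\beta_1|+|\beta_2|\neq0$ and $|\delta_1|+|\delta_2|\neq0$, and let $\lambda\in\mathbb{C}$. Consider the equation $$(a(x)u''(x))''+q(x)u(x)=\lambda u(x).\qquad(E)$$ The functions $\phi_{ij}(x,\lambda)$ are solutions of (E); $\phi_{11},\phi_{21}$ live on $[-1,0)$ and $\phi_{12},\phi_{22}$ on $(0,1]$. Values at $0$ are the corresponding one-sided limits, and primes denote derivatives in $x$. They are determined by the following initial conditions.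 $\phi_{11}$: $\phi_{11}(-1)=\phi_{11}'(-1)=\phi_{11}''(-1)=0$, $\phi_{11}'''(-1)=-1$. $\phi_{21}$: $\phi_{21}(-1)=0$, $\phi_{21}'(-1)=\beta_2$, $\phi_{21}''(-1)=-\beta_1$, $\phi_{21}'''(-1)=0$. For $i=1,2$, $\phi_{i2}$: $\phi_{i2}(0)=\phi_{i1}(0)$, $\phi_{i2}'(0)=\phi_{i1}'(0)$, $\phi_{i2}''(0)=\phi_{i1}''(0)-\lambda\delta_1\phi_{i1}'(0)$, $\phi_{i2}'''(0)=\phi_{i1}'''(0)-\lambda\delta_2\phi_{i1}(0)$. In the formulae, $\phi_{i1}(0)$ and $\phi_{i1}'(0)$ abbreviate $\phi_{i1}(0,\lambda)$ and $\phi_{i1}'(0,\lambda)$. *)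

theory Defs
  imports "HOL-Analysis.Analysis" "HOL-Library.Landau_Symbols"
begin

abbreviation I_left :: "real set" where "I_left \<equiv> {-1..<0}"

abbreviation I_right :: "real set" where "I_right \<equiv> {0<..1}"

text \<open>Derivative of a complex-valued function of a real variable relative to an interval \<open>S\<close>:
  two-sided inside \<open>S\<close>, one-sided at an end point belonging to \<open>S\<close>.
  Only the values of \<open>f\<close> on \<open>S\<close> matter when \<open>x \<in> S\<close>.\<close>

definition dx :: "real set \<Rightarrow> (real \<Rightarrow> complex) \<Rightarrow> real \<Rightarrow> complex" where
  "dx S f x = vector_derivative f (at x within S)"

abbreviation dxn :: "real set \<Rightarrow> nat \<Rightarrow> (real \<Rightarrow> complex) \<Rightarrow> real \<Rightarrow> complex" where
  "dxn S k \<equiv> dx S ^^ k"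

definition a_coeff :: "real \<Rightarrow> real \<Rightarrow> real \<Rightarrow> real" where
  "a_coeff a1 a2 x = (if x < 0 then a1 ^ 4 else a2 ^ 4)"

text \<open>\<open>u\<close> is a classical solution on \<open>S\<close> of \<open>(a u'')'' + q u = l u\<close>. Differentiability is
  required explicitly, because \<^const>\<open>vector_derivative\<close> is arbitrary where no derivative
  exists.\<close>

definition solves_on ::
  "real set \<Rightarrow> (real \<Rightarrow> real) \<Rightarrow> (real \<Rightarrow> real) \<Rightarrow> complex \<Rightarrow> (real \<Rightarrow> complex) \<Rightarrow> bool" where
  "solves_on S a q l u \<longleftrightarrow>
     (let w = (\<lambda>x. of_real (a x) * dxn S 2 u x) in
      \<forall>x\<in>S. u differentiable (at x within S) \<and>
             dx S u differentiable (at x within S) \<and>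
             w differentiable (at x within S) \<and>
             dx S w differentiable (at x within S) \<and>
             dxn S 2 w x + of_real (q x) * u x = l * u x)"

text \<open>The value at \<open>0\<close> of the \<open>k\<close>-th derivative of a function living on \<^term>\<open>I_left\<close>.
  The limit exists for every solution, as \<open>q\<close> is bounded near \<open>0\<close>.\<close>

definition left_value :: "nat \<Rightarrow> (real \<Rightarrow> complex) \<Rightarrow> complex" where
  "left_value k u = Lim (at_left 0) (dxn I_left k u)"

text \<open>Transmission conditions at \<open>0\<close>, linking \<open>u\<close> on \<^term>\<open>I_left\<close> to \<open>v\<close> on
  \<^term>\<open>I_right\<close>.\<close>

definition transmission ::
  "real \<Rightarrow> real \<Rightarrow> complex \<Rightarrow> (real \<Rightarrow> complex) \<Rightarrow> (real \<Rightarrow> complex) \<Rightarrow> bool" where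
  "transmission \<delta>1 \<delta>2 l u v \<longleftrightarrow>
     (dxn I_right 0 v \<longlongrightarrow> left_value 0 u) (at_right 0) \<and>
     (dxn I_right 1 v \<longlongrightarrow> left_value 1 u) (at_right 0) \<and>
     (dxn I_right 2 v \<longlongrightarrow> left_value 2 u - l * of_real \<delta>1 * left_value 1 u) (at_right 0) \<and>
     (dxn I_right 3 v \<longlongrightarrow> left_value 3 u - l * of_real \<delta>2 * left_value 0 u) (at_right 0)"

text \<open>The filter for \<open>s \<rightarrow> \<infinity>\<close> in the complex plane, uniformly in \<open>x \<in> S\<close>: membership in
  \<open>O[unif_at_infinity S](g)\<close> means that one constant and one lower bound on \<open>\<bar>s\<bar>\<close> serve
  all \<open>x \<in> S\<close>. For \<open>l = s ^ 4\<close> it is the same as \<open>\<bar>l\<bar> \<rightarrow> \<infinity>\<close>.\<close>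

abbreviation unif_at_infinity :: "real set \<Rightarrow> (complex \<times> real) filter" where
  "unif_at_infinity S \<equiv> at_infinity \<times>\<^sub>F principal S"

end

theory Submission imports Defs begin

text \<open>On each half of the domain the leading coefficient is a constant \<open>a\<^sup>4\<close>, and with \<open>\<tau> = s / a\<close>
  the equation reads \<open>u'''' = (\<tau>\<^sup>4 - p) u\<close> with the bounded function \<open>p = q / a\<^sup>4\<close>. For large \<open>\<tau>\<close>
  this is a small perturbation of \<open>y'''' = \<tau>\<^sup>4 y\<close>, whose solutions are the four combinations
  \<open>krylov m\<close> of \<open>exp (\<omega> \<tau> x)\<close>, \<open>\<omega>\<^sup>4 = 1\<close>. All formulae follow from a quantitative form of this
  statement, \<open>perturbation_estimate\<close>: \<open>u\<close> and the unperturbed solution \<open>y\<close> with the same initial data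
  at \<open>c\<close> satisfy
  \<open>\<bar>u\<^sup>(\<^sup>k\<^sup>)(x) - y\<^sup>(\<^sup>k\<^sup>)(x)\<bar> \<le> 2 P \<bar>\<tau>\<bar> ^ (k - 6) N exp (\<bar>\<tau>\<bar> (x - c))\<close>, where
  \<open>N = (\<Sum>j<4. \<bar>\<tau>\<bar> ^ (3 - j) \<bar>u\<^sup>(\<^sup>j\<^sup>)(c)\<bar>)\<close> measures the data and \<open>P\<close> bounds \<open>p\<close>;
  this needs \<open>x - c \<le> 1\<close> and \<open>2 P \<le> \<bar>\<tau>\<bar>\<^sup>3\<close>.

  The proof of the estimate uses no integral equation. The operator \<open>D\<^sup>4 - \<tau>\<^sup>4\<close> factors over the
  fourth roots of unity, and the modes \<open>z\<^sub>\<omega> = u''' + \<omega> \<tau> u'' + (\<omega> \<tau>)\<^sup>2 u' + (\<omega> \<tau>)\<^sup>3 u\<close> satisfy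
  \<open>z\<^sub>\<omega>' = \<omega> \<tau> z\<^sub>\<omega> - p u\<close>. If \<open>\<bar>u(t)\<bar> \<le> m exp (\<bar>\<tau>\<bar> (t - c))\<close>, the mean value inequality shows that
  \<open>z\<^sub>\<omega>\<close> differs from its free propagation by at most \<open>P m exp (\<bar>\<tau>\<bar> (x - c))\<close>. As
  \<open>4 \<tau> ^ (3 - k) u\<^sup>(\<^sup>k\<^sup>)\<close> is a combination of the modes with unimodular coefficients, \<open>u\<close> is
  controlled with a gain of three powers of \<open>\<tau>\<close>; this first bounds the best \<open>m\<close> by
  \<open>2 N \<bar>\<tau>\<bar> ^ (- 3)\<close> and then gives the estimate.

  On the left half, the initial data of the two solutions have \<open>N = 1\<close> and \<open>N = O(\<bar>\<tau>\<bar>\<^sup>2)\<close>, so both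
  have derivatives \<open>O(\<bar>s\<bar> ^ (k - 1) exp (\<bar>s\<bar> (x + 1) / a1))\<close>, also in the limit at \<open>0\<close>; the leading
  term of the second solution comes from its initial slope. On the right half, the transmission
  conditions split the data at \<open>0\<close> into the values carried over from the left and the jumps. The jumps
  produce exactly the explicit terms, and everything else is \<open>O(\<bar>s\<bar> ^ (k - 1))\<close> times the
  exponential, for both solutions alike.\<close>

section \<open>Fundamental solutions of the unperturbed equation\<close>

text \<open>The beam functions of Krylov and Duncan: for \<open>m = 0, 1, 2, 3\<close> they are
  \<open>(cosh z + cos z)/2\<close>, \<open>(sinh z - sin z)/2\<close>, \<open>(cosh z - cos z)/2\<close> and \<open>(sinh z + sin z)/2\<close>,
  continued periodically in \<open>m\<close>. In this indexing, differentiation raises the index by one.\<close>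

definition krylov :: "nat \<Rightarrow> complex \<Rightarrow> complex" where
  "krylov m z = (\<Sum>n<4. (\<i> ^ n) ^ m * exp (\<i> ^ n * z)) / 4"

lemma sum_lessThan_4: "(\<Sum>n<4. f n) = f 0 + f 1 + f 2 + f 3" for f :: "nat \<Rightarrow> 'a :: comm_monoid_add"
  by (simp add: eval_nat_numeral)

lemma i_power_power_4: "(\<i> ^ n) ^ 4 = 1"
proof -
  have "(\<i> ^ n) ^ 4 = (\<i> ^ 4) ^ n"
    by (simp only: power_mult [symmetric] mult.commute)
  then show ?thesis
    by simp
qed

lemma i_power_3: "\<i> ^ 3 = - \<i>"
  by (simp add: eval_nat_numeral)

text \<open>Orthogonality of the characters of \<open>\<int>/4\<close>; it inverts the passage from derivatives to modes
  below.\<close>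

lemma sum_i_powers:
  assumes "k < 4" and "j < 4"
  shows "(\<Sum>n<4. (\<i> ^ n) ^ (k + 1) * (\<i> ^ n) ^ (3 - j)) = (if j = k then 4 else 0)"
proof -
  have "k \<in> {0, 1, 2, 3}" "j \<in> {0, 1, 2, 3}"
    using assms by auto
  then show ?thesis
    by (elim insertE emptyE) (simp_all add: sum_lessThan_4 i_power_3 eval_nat_numeral)
qed

lemma norm_krylov_le: "cmod (krylov m z) \<le> exp (cmod z)"
proof -
  have "cmod (\<Sum>n<4. (\<i> ^ n) ^ m * exp (\<i> ^ n * z)) \<le> (\<Sum>n<(4::nat). exp (cmod z))"
  proof (rule sum_norm_le)
    fix n :: nat
    have "cmod ((\<i> ^ n) ^ m * exp (\<i> ^ n * z)) = cmod (exp (\<i> ^ n * z))"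
      by (simp add: norm_mult norm_power)
    also have "\<dots> \<le> exp (cmod (\<i> ^ n * z))"
      by (rule norm_exp)
    finally show "cmod ((\<i> ^ n) ^ m * exp (\<i> ^ n * z)) \<le> exp (cmod z)"
      by (simp add: norm_mult norm_power)
  qed
  then show ?thesis
    by (simp add: krylov_def norm_divide)
qed

lemma krylov_has_field_derivative:
  "(krylov m has_field_derivative krylov (Suc m) z) (at z within S)"
  unfolding krylov_def [abs_def]
  by (rule derivative_eq_intros refl | simp)+ (simp add: algebra_simps)

lemma krylov_has_vector_derivative:
  "((\<lambda>t. krylov m (\<tau> * of_real (t - c))) has_vector_derivative
     \<tau> * krylov (Suc m) (\<tau> * of_real (t - c))) (at t within S)"
proof -
  have "((\<lambda>t. \<tau> * of_real (t - c)) has_vector_derivative \<tau>) (at t within S)"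
    by (rule derivative_eq_intros refl | simp)+
  from field_vector_diff_chain_within [OF this krylov_has_field_derivative]
  show ?thesis
    by (simp add: o_def)
qed

lemma cos_eq_krylov: "cos z = krylov 0 z - krylov 2 z"
  and sin_eq_krylov: "sin z = krylov 3 z - krylov 1 z"
  and exp_plus_eq_krylov: "exp z + exp (- z) = 2 * krylov 0 z + 2 * krylov 2 z"
  and exp_minus_eq_krylov: "exp z - exp (- z) = 2 * krylov 1 z + 2 * krylov 3 z"
  by (simp_all add: krylov_def sum_lessThan_4 i_power_3 cos_exp_eq sin_exp_eq field_simps)

section \<open>Perturbation of the fourth-order operator\<close>

text \<open>Since \<open>D\<^sup>4 - \<tau>\<^sup>4\<close> is the product of \<open>D - \<omega>\<tau>\<close> over the fourth roots of unity \<open>\<omega>\<close>, applying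
  the three factors other than \<open>D - \<omega>\<tau>\<close> to \<open>u\<close> leaves a quantity that solves a first-order
  equation. For \<open>\<omega> = \<i>\<^sup>n\<close> this quantity is \<open>factor_mode\<close>, evaluated on the list
  \<open>B j = u\<^sup>(\<^sup>j\<^sup>)(t)\<close>.\<close>

definition factor_mode ::
  "complex \<Rightarrow> (nat \<Rightarrow> complex) \<Rightarrow> nat \<Rightarrow> complex" where
  "factor_mode \<tau> B n = (\<Sum>j<4. (\<i> ^ n * \<tau>) ^ (3 - j) * B j)"

text \<open>Up to the factor \<open>\<tau> ^ (k - 3)\<close> this is the \<open>k\<close>-th derivative, at distance \<open>z / \<tau>\<close> from the
  initial point, of the solution of \<open>y'''' = \<tau>\<^sup>4 y\<close> with initial data \<open>B\<close>. The factor is split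
  off to avoid negative powers of \<open>\<tau>\<close>.\<close>

definition unperturbed ::
  "complex \<Rightarrow> (nat \<Rightarrow> complex) \<Rightarrow> nat \<Rightarrow> complex \<Rightarrow> complex" where
  "unperturbed \<tau> B k z = (\<Sum>j<4. \<tau> ^ (3 - j) * B j * krylov (k + 4 - j) z)"

text \<open>The natural weighting of initial data: a common bound for the moduli of all four modes at the
  initial point, when \<open>r\<close> is the modulus of \<open>\<tau>\<close>.\<close>

definition data_size :: "real \<Rightarrow> (nat \<Rightarrow> complex) \<Rightarrow> real" where
  "data_size r B = (\<Sum>j<4. r ^ (3 - j) * cmod (B j))"

lemma data_size_nonneg: "0 \<le> r \<Longrightarrow> 0 \<le> data_size r B"
  unfolding data_size_def by (intro sum_nonneg mult_nonneg_nonneg) auto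

text \<open>Fourier inversion over the four roots of unity: every derivative is an average of modes.\<close>

lemma derivative_from_modes:
  assumes "k < 4"
  shows "\<tau> ^ 3 * B k = \<tau> ^ k * ((\<Sum>n<4. (\<i> ^ n) ^ (k + 1) * factor_mode \<tau> B n) / 4)"
proof -
  have "(\<Sum>n<4. (\<i> ^ n) ^ (k + 1) * factor_mode \<tau> B n)
      = (\<Sum>n<4. \<Sum>j<4. \<tau> ^ (3 - j) * B j * ((\<i> ^ n) ^ (k + 1) * (\<i> ^ n) ^ (3 - j)))"
    by (simp add: factor_mode_def sum_distrib_left power_mult_distrib mult_ac)
  also have "\<dots> = (\<Sum>j<4. \<Sum>n<4. \<tau> ^ (3 - j) * B j * ((\<i> ^ n) ^ (k + 1) * (\<i> ^ n) ^ (3 - j)))"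
    by (rule sum.swap)
  also have "\<dots> = (\<Sum>j<4. \<tau> ^ (3 - j) * B j * (\<Sum>n<4. (\<i> ^ n) ^ (k + 1) * (\<i> ^ n) ^ (3 - j)))"
    by (simp add: sum_distrib_left)
  also have "\<dots> = (\<Sum>j<4. if j = k then \<tau> ^ (3 - j) * B j * 4 else 0)"
    by (intro sum.cong refl) (use assms sum_i_powers in simp)
  also have "\<dots> = 4 * \<tau> ^ (3 - k) * B k"
    using assms by simp
  finally show ?thesis
    using assms by (simp add: power_add [symmetric])
qed

text \<open>The unperturbed solution is what the inversion formula gives when each mode at the initial
  point is propagated by its own exponential.\<close>

lemma unperturbed_eq_modes:
  "unperturbed \<tau> B k z = (\<Sum>n<4. (\<i> ^ n) ^ (k + 1) * (exp (\<i> ^ n * z) * factor_mode \<tau> B n)) / 4"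
proof -
  have "unperturbed \<tau> B k z = (\<Sum>j<4. \<Sum>n<4. (\<i> ^ n) ^ (k + 1) * (exp (\<i> ^ n * z) * ((\<i> ^ n * \<tau>) ^ (3 - j) * B j))) / 4"
  proof -
    have *: "(\<i> ^ n) ^ (k + 4 - j) = (\<i> ^ n) ^ (k + 1) * (\<i> ^ n) ^ (3 - j)" if "j < 4" for j n
    proof -
      have "k + 4 - j = (k + 1) + (3 - j)"
        using that by simp
      then show ?thesis
        by (simp only: power_add)
    qed
    show ?thesis
      unfolding unperturbed_def krylov_def sum_divide_distrib sum_distrib_left
      by (intro sum.cong refl) (simp add: * power_mult_distrib mult_ac)
  qed
  also have "\<dots> = (\<Sum>n<4. \<Sum>j<4. (\<i> ^ n) ^ (k + 1) * (exp (\<i> ^ n * z) * ((\<i> ^ n * \<tau>) ^ (3 - j) * B j))) / 4"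
    by (subst sum.swap) (rule refl)
  finally show ?thesis
    by (simp only: factor_mode_def sum_distrib_left)
qed

lemma norm_unperturbed_le:
  "cmod (unperturbed \<tau> B k z) \<le> data_size (cmod \<tau>) B * exp (cmod z)"
  unfolding unperturbed_def data_size_def sum_distrib_right
proof (rule sum_norm_le)
  fix j
  have "cmod (\<tau> ^ (3 - j) * B j) * cmod (krylov (k + 4 - j) z)
      \<le> cmod (\<tau> ^ (3 - j) * B j) * exp (cmod z)"
    by (intro mult_left_mono norm_krylov_le norm_ge_zero)
  then show "cmod (\<tau> ^ (3 - j) * B j * krylov (k + 4 - j) z) \<le> cmod \<tau> ^ (3 - j) * cmod (B j) * exp (cmod z)"
    by (simp add: norm_mult norm_power)
qed

text \<open>The payoff of the factorisation: each mode obeys a scalar first-order equation driven by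
  \<open>p u\<close> only.\<close>

lemma factor_mode_derivative:
  assumes "\<And>j. j < 3 \<Longrightarrow> (f j has_vector_derivative f (Suc j) t) (at t)"
    and "(f 3 has_vector_derivative (\<tau> ^ 4 - p) * f 0 t) (at t)"
  shows "((\<lambda>t. factor_mode \<tau> (\<lambda>j. f j t) n) has_vector_derivative
           \<i> ^ n * \<tau> * factor_mode \<tau> (\<lambda>j. f j t) n - p * f 0 t) (at t)"
proof -
  define w where "w = \<i> ^ n * \<tau>"
  have w4: "w ^ 4 = \<tau> ^ 4"
    by (simp add: w_def power_mult_distrib i_power_power_4)
  have f: "(f 0 has_vector_derivative f 1 t) (at t)" "(f 1 has_vector_derivative f 2 t) (at t)"
    "(f 2 has_vector_derivative f 3 t) (at t)"
    using assms(1) [of 0] assms(1) [of 1] assms(1) [of 2] by (simp_all add: eval_nat_numeral)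
  have "((\<lambda>t. w ^ 3 * f 0 t + w ^ 2 * f 1 t + w * f 2 t + f 3 t) has_vector_derivative
          w ^ 3 * f 1 t + w ^ 2 * f 2 t + w * f 3 t + (w ^ 4 - p) * f 0 t) (at t)"
    unfolding w4
    by (intro has_vector_derivative_add has_vector_derivative_mult_right f assms(2))
  moreover have "w ^ 3 * f 1 t + w ^ 2 * f 2 t + w * f 3 t + (w ^ 4 - p) * f 0 t
      = w * (w ^ 3 * f 0 t + w ^ 2 * f 1 t + w * f 2 t + f 3 t) - p * f 0 t"
    by (simp add: algebra_simps eval_nat_numeral)
  ultimately show ?thesis
    by (simp add: factor_mode_def sum_lessThan_4 flip: w_def)
qed

text \<open>Instead of a variation-of-constants integral, the mean value inequality is applied on \<open>[c, d]\<close>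
  to \<open>t \<mapsto> exp (\<omega> \<tau> (d - t)) z(t)\<close>, with the end point \<open>d\<close> frozen in the exponent. The derivative
  of this function is \<open>- exp (\<omega> \<tau> (d - t)) p(t) u(t)\<close>; the growth \<open>exp (\<bar>\<tau>\<bar> (t - c))\<close> of \<open>u\<close> and
  the factor \<open>exp (\<bar>\<tau>\<bar> (d - t))\<close> multiply to something independent of \<open>t\<close>, so nothing is lost
  to the mean value.\<close>

lemma factor_mode_deviation:
  assumes "c \<le> d" and "d - c \<le> 1"
    and cont: "\<And>j. j < 4 \<Longrightarrow> continuous_on {c..d} (f j)"
    and deriv: "\<And>j t. j < 3 \<Longrightarrow> c < t \<Longrightarrow> t < d \<Longrightarrow> (f j has_vector_derivative f (Suc j) t) (at t)"
    and ode: "\<And>t. c < t \<Longrightarrow> t < d \<Longrightarrow> (f 3 has_vector_derivative (\<tau> ^ 4 - p t) * f 0 t) (at t)"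
    and p: "\<And>t. c < t \<Longrightarrow> t < d \<Longrightarrow> cmod (p t) \<le> P"
    and m: "\<And>t. c < t \<Longrightarrow> t < d \<Longrightarrow> cmod (f 0 t) \<le> m * exp (cmod \<tau> * (t - c))"
    and "0 \<le> P" and "0 \<le> m"
  shows "cmod (factor_mode \<tau> (\<lambda>j. f j d) n
            - exp (\<i> ^ n * (\<tau> * of_real (d - c))) * factor_mode \<tau> (\<lambda>j. f j c) n)
       \<le> P * m * exp (cmod \<tau> * (d - c))"
proof (cases "c = d")
  case True
  then show ?thesis
    using \<open>0 \<le> P\<close> \<open>0 \<le> m\<close> by simp
next
  case False
  then have "c < d"
    using \<open>c \<le> d\<close> by simp
  define w where "w = \<i> ^ n * \<tau>"
  have norm_w: "cmod w = cmod \<tau>"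
    by (simp add: w_def norm_mult norm_power)
  define z where "z t = factor_mode \<tau> (\<lambda>j. f j t) n" for t
  define g where "g t = exp (w * of_real (d - t)) * z t" for t
  define g' where "g' t = - (exp (w * of_real (d - t)) * (p t * f 0 t))" for t
  have "continuous_on {c..d} z"
    unfolding z_def factor_mode_def by (intro continuous_intros cont) auto
  then have "continuous_on {c..d} g"
    unfolding g_def by (intro continuous_intros)
  moreover have g_deriv: "(g has_vector_derivative g' t) (at t)" if "c < t" "t < d" for t
  proof -
    have 1: "(z has_vector_derivative w * z t - p t * f 0 t) (at t)"
      unfolding z_def w_def by (rule factor_mode_derivative) (use that deriv ode in auto)
    have 2: "((\<lambda>t. exp (w * of_real (d - t))) has_vector_derivative - w * exp (w * of_real (d - t))) (at t)"
    proof -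
      have "((\<lambda>t. w * of_real (d - t)) has_vector_derivative - w) (at t)"
        by (rule derivative_eq_intros refl | simp)+
      from field_vector_diff_chain_within [OF this DERIV_subset [OF DERIV_exp]]
      show ?thesis
        by (simp add: o_def)
    qed
    show ?thesis
      using has_vector_derivative_mult [OF 2 1]
      unfolding g_def g'_def by (simp add: algebra_simps)
  qed
  ultimately obtain t where t: "t \<in> {c<..<d}" and le: "cmod (g d - g c) \<le> cmod ((d - c) *\<^sub>R g' t)"
    using mvt_general [OF \<open>c < d\<close>, of g "\<lambda>t h. h *\<^sub>R g' t"]
    by (auto simp: has_vector_derivative_def)
  have "cmod (exp (w * of_real (d - t))) \<le> exp (cmod \<tau> * (d - t))"
    using norm_exp [of "w * of_real (d - t)"] t by (simp add: norm_mult norm_w del: of_real_diff)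
  moreover have "cmod (p t * f 0 t) \<le> P * (m * exp (cmod \<tau> * (t - c)))"
    unfolding norm_mult using t by (intro mult_mono p m \<open>0 \<le> P\<close>) auto
  ultimately have "cmod (g' t) \<le> exp (cmod \<tau> * (d - t)) * (P * (m * exp (cmod \<tau> * (t - c))))"
    unfolding g'_def norm_minus_cancel norm_mult [of "exp _"] by (intro mult_mono) auto
  also have "\<dots> = P * m * exp (cmod \<tau> * (d - c))"
    by (simp add: algebra_simps flip: exp_add)
  finally have "cmod (g' t) \<le> P * m * exp (cmod \<tau> * (d - c))" .
  moreover have "cmod ((d - c) *\<^sub>R g' t) \<le> 1 * cmod (g' t)"
    unfolding norm_scaleR using \<open>c < d\<close> \<open>d - c \<le> 1\<close> by (intro mult_right_mono) auto
  ultimately show ?thesis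
    using le by (simp add: g_def z_def w_def mult.assoc)
qed

text \<open>Averaging the mode estimates turns an a priori growth bound on \<open>u\<close> into closeness to the
  unperturbed solution, with a gain of \<open>\<bar>\<tau>\<bar> ^ 3\<close>.\<close>

lemma conditional_deviation:
  assumes "c \<le> d" and "d - c \<le> 1"
    and cont: "\<And>j. j < 4 \<Longrightarrow> continuous_on {c..d} (f j)"
    and deriv: "\<And>j t. j < 3 \<Longrightarrow> c < t \<Longrightarrow> t < d \<Longrightarrow> (f j has_vector_derivative f (Suc j) t) (at t)"
    and ode: "\<And>t. c < t \<Longrightarrow> t < d \<Longrightarrow> (f 3 has_vector_derivative (\<tau> ^ 4 - p t) * f 0 t) (at t)"
    and p: "\<And>t. c < t \<Longrightarrow> t < d \<Longrightarrow> cmod (p t) \<le> P"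
    and m: "\<And>t. c < t \<Longrightarrow> t < d \<Longrightarrow> cmod (f 0 t) \<le> m * exp (cmod \<tau> * (t - c))"
    and "0 \<le> P" and "0 \<le> m" and "k < 4"
  shows "cmod (\<tau> ^ 3 * f k d - \<tau> ^ k * unperturbed \<tau> (\<lambda>j. f j c) k (\<tau> * of_real (d - c)))
       \<le> cmod \<tau> ^ k * (P * m * exp (cmod \<tau> * (d - c)))"
proof -
  let ?D = "\<lambda>n. factor_mode \<tau> (\<lambda>j. f j d) n
            - exp (\<i> ^ n * (\<tau> * of_real (d - c))) * factor_mode \<tau> (\<lambda>j. f j c) n"
  have "\<tau> ^ 3 * f k d - \<tau> ^ k * unperturbed \<tau> (\<lambda>j. f j c) k (\<tau> * of_real (d - c))
      = \<tau> ^ k * ((\<Sum>n<4. (\<i> ^ n) ^ (k + 1) * ?D n) / 4)"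
    by (simp only: derivative_from_modes [OF \<open>k < 4\<close>, of \<tau> "\<lambda>j. f j d"] unperturbed_eq_modes
        right_diff_distrib sum_subtractf diff_divide_distrib)
  moreover have "cmod (\<Sum>n<4. (\<i> ^ n) ^ (k + 1) * ?D n) \<le> (\<Sum>n<(4::nat). P * m * exp (cmod \<tau> * (d - c)))"
  proof (rule sum_norm_le)
    fix n :: nat
    have "cmod ((\<i> ^ n) ^ (k + 1) * ?D n) = cmod (?D n)"
      by (simp add: norm_mult norm_power)
    also have "\<dots> \<le> P * m * exp (cmod \<tau> * (d - c))"
      by (rule factor_mode_deviation) (fact assms)+
    finally show "cmod ((\<i> ^ n) ^ (k + 1) * ?D n) \<le> P * m * exp (cmod \<tau> * (d - c))" .
  qed
  then have "cmod ((\<Sum>n<4. (\<i> ^ n) ^ (k + 1) * ?D n) / 4) \<le> P * m * exp (cmod \<tau> * (d - c))"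
    by (simp add: norm_divide)
  then have "cmod (\<tau> ^ k * ((\<Sum>n<4. (\<i> ^ n) ^ (k + 1) * ?D n) / 4))
      \<le> cmod \<tau> ^ k * (P * m * exp (cmod \<tau> * (d - c)))"
    unfolding norm_mult [of "\<tau> ^ k"] norm_power [of \<tau> k] by (intro mult_left_mono) auto
  ultimately show ?thesis
    by (simp only:)
qed

text \<open>The growth bound is bootstrapped. Let \<open>m\<close> be the maximum of
  \<open>\<bar>u(t)\<bar> exp (- \<bar>\<tau>\<bar> (t - c))\<close> on \<open>[c, d]\<close>. The previous lemma at the point of maximum gives
  \<open>\<bar>\<tau>\<bar>\<^sup>3 m \<le> data_size + P m\<close>, and for large \<open>\<tau>\<close> the last term is absorbed on the left. A second
  use of the lemma, now with this \<open>m\<close>, gives the estimate.\<close>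

lemma perturbation_estimate:
  assumes "c \<le> d" and "d - c \<le> 1"
    and cont: "\<And>j. j < 4 \<Longrightarrow> continuous_on {c..d} (f j)"
    and deriv: "\<And>j t. j < 3 \<Longrightarrow> c < t \<Longrightarrow> t < d \<Longrightarrow> (f j has_vector_derivative f (Suc j) t) (at t)"
    and ode: "\<And>t. c < t \<Longrightarrow> t < d \<Longrightarrow> (f 3 has_vector_derivative (\<tau> ^ 4 - p t) * f 0 t) (at t)"
    and p: "\<And>t. c < t \<Longrightarrow> t < d \<Longrightarrow> cmod (p t) \<le> P"
    and "0 \<le> P" and large: "2 * P \<le> cmod \<tau> ^ 3" and "k < 4"
  shows "cmod \<tau> ^ 3 * cmod (\<tau> ^ 3 * f k d - \<tau> ^ k * unperturbed \<tau> (\<lambda>j. f j c) k (\<tau> * of_real (d - c)))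
       \<le> 2 * P * data_size (cmod \<tau>) (\<lambda>j. f j c) * (cmod \<tau> ^ k * exp (cmod \<tau> * (d - c)))"
proof -
  let ?N = "data_size (cmod \<tau>) (\<lambda>j. f j c)"
  \<comment> \<open>The maximum of \<open>v\<close> is the best constant \<open>m\<close> in the growth bound.\<close>
  define v where "v t = cmod (f 0 t) * exp (- (cmod \<tau> * (t - c)))" for t
  have "continuous_on {c..d} v"
    unfolding v_def by (intro continuous_intros cont) auto
  then obtain e where e: "e \<in> {c..d}" and v_le: "\<And>t. t \<in> {c..d} \<Longrightarrow> v t \<le> v e"
    using continuous_attains_sup [of "{c..d}" v] \<open>c \<le> d\<close> by auto
  have bound: "cmod (f 0 t) \<le> v e * exp (cmod \<tau> * (t - c))" if "t \<in> {c..d}" for t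
  proof -
    have "cmod (f 0 t) = v t * exp (cmod \<tau> * (t - c))"
      by (simp add: v_def flip: exp_add)
    then show ?thesis
      using v_le [OF that] by simp
  qed
  have eq: "cmod (f 0 e) = v e * exp (cmod \<tau> * (e - c))"
    by (simp add: v_def flip: exp_add)
  have "0 \<le> v e"
    by (simp add: v_def)
  let ?U = "unperturbed \<tau> (\<lambda>j. f j c) 0 (\<tau> * of_real (e - c))"
  have "cmod (\<tau> ^ 3 * f 0 e - \<tau> ^ 0 * ?U) \<le> cmod \<tau> ^ 0 * (P * v e * exp (cmod \<tau> * (e - c)))"
    by (rule conditional_deviation [where p = p])
      (use e \<open>d - c \<le> 1\<close> \<open>0 \<le> P\<close> \<open>0 \<le> v e\<close> in \<open>auto intro: bound deriv ode p continuous_on_subset [OF cont]\<close>)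
  moreover have "cmod ?U \<le> ?N * exp (cmod \<tau> * (e - c))"
    using norm_unperturbed_le [of \<tau> "\<lambda>j. f j c" 0 "\<tau> * of_real (e - c)"] e
    by (simp add: norm_mult del: of_real_diff)
  ultimately have "cmod (\<tau> ^ 3 * f 0 e) \<le> (?N + P * v e) * exp (cmod \<tau> * (e - c))"
    using norm_triangle_sub [of "\<tau> ^ 3 * f 0 e" ?U] by (simp add: distrib_right)
  then have "cmod \<tau> ^ 3 * v e * exp (cmod \<tau> * (e - c)) \<le> (?N + P * v e) * exp (cmod \<tau> * (e - c))"
    by (simp add: norm_mult norm_power eq)
  then have "cmod \<tau> ^ 3 * v e \<le> ?N + P * v e"
    by simp
  moreover have "2 * P * v e \<le> cmod \<tau> ^ 3 * v e"
    using large \<open>0 \<le> v e\<close> by (rule mult_right_mono)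
  ultimately have ve: "cmod \<tau> ^ 3 * v e \<le> 2 * ?N"
    by linarith
  have "cmod (\<tau> ^ 3 * f k d - \<tau> ^ k * unperturbed \<tau> (\<lambda>j. f j c) k (\<tau> * of_real (d - c)))
       \<le> cmod \<tau> ^ k * (P * v e * exp (cmod \<tau> * (d - c)))"
    by (rule conditional_deviation [where p = p])
      (use assms \<open>0 \<le> v e\<close> in \<open>auto intro: bound\<close>)
  then have "cmod \<tau> ^ 3 * cmod (\<tau> ^ 3 * f k d - \<tau> ^ k * unperturbed \<tau> (\<lambda>j. f j c) k (\<tau> * of_real (d - c)))
       \<le> cmod \<tau> ^ 3 * (cmod \<tau> ^ k * (P * v e * exp (cmod \<tau> * (d - c))))"
    by (rule mult_left_mono) simp
  also have "\<dots> = P * (cmod \<tau> ^ 3 * v e) * (cmod \<tau> ^ k * exp (cmod \<tau> * (d - c)))"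
    by (simp add: mult_ac)
  also have "\<dots> \<le> P * (2 * ?N) * (cmod \<tau> ^ k * exp (cmod \<tau> * (d - c)))"
    by (intro mult_right_mono mult_left_mono ve \<open>0 \<le> P\<close>) auto
  finally show ?thesis
    by (simp add: mult_ac)
qed

section \<open>Derivatives along a half-open interval\<close>

text \<open>Both halves of the domain in one notion; the initial point \<open>c\<close> belongs to the left half but not
  to the right one.\<close>

definition unit_interval_at :: "real \<Rightarrow> real set \<Rightarrow> bool" where
  "unit_interval_at c S \<longleftrightarrow> S = {c..<c + 1} \<or> S = {c<..c + 1}"

lemma unit_interval_at_I_left: "unit_interval_at (- 1) I_left"
  and unit_interval_at_I_right: "unit_interval_at 0 I_right"
  by (simp_all add: unit_interval_at_def)

lemma unit_interval_at_bounds: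
  assumes "unit_interval_at c S" and "x \<in> S"
  shows "c \<le> x" and "x - c \<le> 1"
  using assms by (auto simp: unit_interval_at_def)

lemma unit_interval_at_subset:
  assumes "unit_interval_at c S" and "x \<in> S"
  shows "{c<..x} \<subseteq> S"
  using assms by (auto simp: unit_interval_at_def)

lemma at_within_unit_interval_nontrivial:
  assumes "unit_interval_at c S" and "x \<in> S"
  shows "at x within S \<noteq> bot"
proof -
  have "connected S" and mem: "c + 1 / 2 \<in> S" "c + 1 / 3 \<in> S"
    using assms(1) by (auto simp: unit_interval_at_def)
  moreover have "S \<noteq> {y}" for y
    using mem by auto
  ultimately have "x islimpt S"
    using \<open>x \<in> S\<close> by (intro connected_imp_perfect) auto
  then show ?thesis
    by (simp add: trivial_limit_within)
qed

lemma dx_cong: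
  assumes "\<And>t. t \<in> S \<Longrightarrow> f t = g t" and "x \<in> S"
  shows "dx S f x = dx S g x"
proof -
  have "(f has_vector_derivative d) (at x within S) \<longleftrightarrow> (g has_vector_derivative d) (at x within S)" for d
    using assms by (auto intro: has_vector_derivative_transform [rotated 2])
  then show ?thesis
    by (simp add: dx_def vector_derivative_def)
qed

lemma dxn_eqI:
  assumes S: "unit_interval_at c S"
    and F: "\<And>j x. j < k \<Longrightarrow> x \<in> S \<Longrightarrow> (F j has_vector_derivative F (Suc j) x) (at x within S)"
    and "x \<in> S"
  shows "dxn S k (F 0) x = F k x"
  using F \<open>x \<in> S\<close>
proof (induction k arbitrary: x)
  case 0
  then show ?case by simp
next
  case (Suc k)
  have "dx S (dxn S k (F 0)) x = dx S (F k) x"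
    by (rule dx_cong) (use Suc in auto)
  also have "\<dots> = F (Suc k) x"
    unfolding dx_def
    by (rule vector_derivative_within [OF at_within_unit_interval_nontrivial [OF S]]) (use Suc.prems in auto)
  finally show ?case by simp
qed

lemma dxn_krylov_combination:
  assumes "unit_interval_at c S" and "x \<in> S"
  shows "dxn S k (\<lambda>y. \<alpha> * krylov m (\<tau> * of_real (y - c)) + \<beta> * krylov n (\<tau> * of_real (y - c))) x
    = \<tau> ^ k * (\<alpha> * krylov (m + k) (\<tau> * of_real (x - c)) + \<beta> * krylov (n + k) (\<tau> * of_real (x - c)))"
proof -
  define F where "F k y = \<tau> ^ k * (\<alpha> * krylov (m + k) (\<tau> * of_real (y - c)) + \<beta> * krylov (n + k) (\<tau> * of_real (y - c)))" for k y
  have "(F j has_vector_derivative F (Suc j) y) (at y within S)" for j y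
  proof -
    have "(F j has_vector_derivative \<tau> ^ j *
        (\<alpha> * (\<tau> * krylov (Suc (m + j)) (\<tau> * of_real (y - c))) + \<beta> * (\<tau> * krylov (Suc (n + j)) (\<tau> * of_real (y - c)))))
        (at y within S)"
      unfolding F_def [abs_def]
      by (intro has_vector_derivative_add has_vector_derivative_mult_right krylov_has_vector_derivative)
    then show ?thesis
      by (simp add: F_def algebra_simps)
  qed
  then have "dxn S k (F 0) x = F k x"
    by (intro dxn_eqI [OF assms(1)] assms(2))
  then show ?thesis
    by (simp add: F_def [abs_def])
qed

section \<open>Solutions of the differential equation\<close>

text \<open>As the leading coefficient is constant on each half, it can be pulled out of the outer two
  derivatives, and the equation becomes a chain of first-order relations for the derivatives
  of \<open>u\<close>.\<close>

lemma solves_on_derivatives: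
  assumes S: "unit_interval_at c S"
    and sol: "solves_on S a q l u"
    and a: "\<And>x. x \<in> S \<Longrightarrow> a x = A" and "A \<noteq> 0"
    and "x \<in> S"
  shows "j < 3 \<Longrightarrow> (dxn S j u has_vector_derivative dxn S (Suc j) u x) (at x within S)"
    and "(dxn S 3 u has_vector_derivative (l - of_real (q x)) / of_real A * u x) (at x within S)"
proof -
  define w where "w = (\<lambda>x. of_real (a x) * dxn S 2 u x)"
  have D: "(f has_vector_derivative dx S f y) (at y within S)"
    if "f differentiable (at y within S)" for f :: "real \<Rightarrow> complex" and y
    using that by (simp add: dx_def vector_derivative_works)
  have sol': "u differentiable (at y within S)" "dx S u differentiable (at y within S)"
    "w differentiable (at y within S)" "dx S w differentiable (at y within S)"
    "dxn S 2 w y + of_real (q y) * u y = l * u y" if "y \<in> S" for y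
    using sol that unfolding solves_on_def w_def Let_def by blast+
  have 0: "(u has_vector_derivative dxn S 1 u y) (at y within S)" if "y \<in> S" for y
    using D [OF sol'(1) [OF that]] by simp
  have 1: "(dxn S 1 u has_vector_derivative dxn S 2 u y) (at y within S)" if "y \<in> S" for y
    using D [OF sol'(2) [OF that]] by (simp add: eval_nat_numeral)
  have D2: "(dxn S 2 u has_vector_derivative dx S w y / of_real A) (at y within S)" if "y \<in> S" for y
  proof (rule has_vector_derivative_transform [OF that])
    show "dxn S 2 u t = w t / of_real A" if "t \<in> S" for t
      using a [OF that] \<open>A \<noteq> 0\<close> by (simp add: w_def)
    show "((\<lambda>t. w t / of_real A) has_vector_derivative dx S w y / of_real A) (at y within S)"
      by (rule has_vector_derivative_divide [OF D [OF sol'(3) [OF that]]])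
  qed
  have dxn3: "dxn S 3 u y = dx S w y / of_real A" if "y \<in> S" for y
  proof -
    have "dxn S 3 u y = dx S (dxn S 2 u) y"
      by (simp add: eval_nat_numeral)
    then show ?thesis
      using vector_derivative_within [OF at_within_unit_interval_nontrivial [OF S that] D2 [OF that]]
      by (simp add: dx_def [of S "dxn S 2 u"])
  qed
  show "(dxn S j u has_vector_derivative dxn S (Suc j) u x) (at x within S)" if "j < 3"
  proof -
    have "j = 0 \<or> j = 1 \<or> j = 2"
      using that by auto
    then show ?thesis
      using 0 [OF \<open>x \<in> S\<close>] 1 [OF \<open>x \<in> S\<close>] D2 [OF \<open>x \<in> S\<close>] dxn3 [OF \<open>x \<in> S\<close>]
      by (auto simp: numeral_3_eq_3 numeral_2_eq_2)
  qed
  show "(dxn S 3 u has_vector_derivative (l - of_real (q x)) / of_real A * u x) (at x within S)"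
  proof (rule has_vector_derivative_transform [OF \<open>x \<in> S\<close> dxn3])
    have "dxn S 2 w x = (l - of_real (q x)) * u x"
      using sol'(5) [OF \<open>x \<in> S\<close>] by (simp add: algebra_simps)
    then have "(dx S w has_vector_derivative (l - of_real (q x)) * u x) (at x within S)"
      using D [OF sol'(4) [OF \<open>x \<in> S\<close>]] by (simp add: numeral_2_eq_2)
    then show "((\<lambda>y. dx S w y / of_real A) has_vector_derivative (l - of_real (q x)) / of_real A * u x) (at x within S)"
      by (auto dest: has_vector_derivative_divide [where a = "of_real A"])
  qed
qed

lemma solves_on_dxn_tendsto:
  assumes S: "unit_interval_at c S"
    and sol: "solves_on S a q l u"
    and a: "\<And>x. x \<in> S \<Longrightarrow> a x = A" and "A \<noteq> 0"
    and "x \<in> S" and "j < 4"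
  shows "(dxn S j u \<longlongrightarrow> dxn S j u x) (at x within S)"
proof -
  have "\<exists>D. (dxn S j u has_vector_derivative D) (at x within S)"
    using solves_on_derivatives(1) [OF S sol a \<open>A \<noteq> 0\<close> \<open>x \<in> S\<close>, of j]
      solves_on_derivatives(2) [OF S sol a \<open>A \<noteq> 0\<close> \<open>x \<in> S\<close>] \<open>j < 4\<close>
    by (cases "j = 3") auto
  then show ?thesis
    using has_vector_derivative_continuous continuous_within by blast
qed

lemma solves_on_dxn_tendsto_start:
  assumes S: "unit_interval_at c S"
    and sol: "solves_on S a q l u"
    and a: "\<And>x. x \<in> S \<Longrightarrow> a x = A" and "A \<noteq> 0"
    and "c \<in> S" and "j < 4"
  shows "(dxn S j u \<longlongrightarrow> dxn S j u c) (at_right c)"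
proof -
  have "(dxn S j u \<longlongrightarrow> dxn S j u c) (at c within {c<..<c + 1})"
    by (rule tendsto_within_subset [OF solves_on_dxn_tendsto [OF S sol a \<open>A \<noteq> 0\<close> \<open>c \<in> S\<close> \<open>j < 4\<close>]])
      (use S in \<open>auto simp: unit_interval_at_def\<close>)
  moreover have "at c within {c<..<c + 1} = at_right c"
    by (rule at_within_nhd [of _ "{..<c + 1}"]) auto
  ultimately show ?thesis
    by simp
qed

text \<open>The perturbation estimate for an actual solution. The initial data are limits at \<open>c\<close> from the
  right, so that both an initial value at \<open>c \<in> S\<close> and a transmission condition at \<open>c \<notin> S\<close> are
  covered.\<close>

lemma solution_deviation:
  assumes S: "unit_interval_at c S"
    and sol: "solves_on S a q (s ^ 4) u"
    and a: "\<And>x. x \<in> S \<Longrightarrow> a x = b ^ 4" and "b \<noteq> 0"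
    and q: "\<And>x. x \<in> S \<Longrightarrow> \<bar>q x\<bar> \<le> b ^ 4 * P" and "0 \<le> P"
    and B: "\<And>j. j < 4 \<Longrightarrow> (dxn S j u \<longlongrightarrow> B j) (at_right c)"
    and \<tau>: "\<tau> = s / of_real b" and large: "2 * P \<le> cmod \<tau> ^ 3"
    and "x \<in> S" and "k < 4"
  shows "cmod \<tau> ^ 3 * cmod (\<tau> ^ 3 * dxn S k u x - \<tau> ^ k * unperturbed \<tau> B k (\<tau> * of_real (x - c)))
       \<le> 2 * P * data_size (cmod \<tau>) B * (cmod \<tau> ^ k * exp (cmod \<tau> * (x - c)))"
proof -
  have b4: "b ^ 4 \<noteq> 0"
    using \<open>b \<noteq> 0\<close> by simp
  have D1: "(dxn S j u has_vector_derivative dxn S (Suc j) u t) (at t within S)" if "t \<in> S" "j < 3" for j t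
    by (rule solves_on_derivatives(1) [OF S sol a b4 that])
  have D2: "(dxn S 3 u has_vector_derivative (s ^ 4 - of_real (q t)) / of_real (b ^ 4) * u t) (at t within S)"
    if "t \<in> S" for t
    by (rule solves_on_derivatives(2) [OF S sol a b4 that])
  \<comment> \<open>The estimate on closed intervals needs values at \<open>c\<close>, even where \<open>u\<close> has none there.\<close>
  define f where "f j t = (if t = c then B j else dxn S j u t)" for j t
  have sub: "{c<..x} \<subseteq> S"
    using unit_interval_at_subset [OF S \<open>x \<in> S\<close>] .
  have f_at: "(f j has_vector_derivative d) (at t)"
    if "(dxn S j u has_vector_derivative d) (at t within S)" "c < t" "t < x" for j d t
  proof -
    have "(dxn S j u has_vector_derivative d) (at t within {c<..<x})"
      by (rule has_vector_derivative_within_subset [OF that(1)]) (use sub in auto)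
    moreover have "at t within {c<..<x} = at t"
      by (rule at_within_open) (use that in auto)
    ultimately have "(dxn S j u has_vector_derivative d) (at t)"
      by (simp only:)
    then show ?thesis
      by (rule has_vector_derivative_transform_within_open [where S = "{c<..<x}"])
        (use that in \<open>auto simp: f_def\<close>)
  qed
  have cont: "continuous_on {c..x} (f j)" if "j < 4" for j
    unfolding continuous_on_def
  proof
    fix t assume t: "t \<in> {c..x}"
    show "(f j \<longlongrightarrow> f j t) (at t within {c..x})"
    proof (cases "t = c")
      case True
      have "(dxn S j u \<longlongrightarrow> B j) (at c within {c..x})"
        by (rule tendsto_within_subset [of _ _ _ "{c..}"]) (auto simp: at_within_Ici_at_right B that)
      then have "(f j \<longlongrightarrow> B j) (at c within {c..x})"
        by (rule Lim_transform_eventually) (auto simp: f_def eventually_at_filter)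
      then show ?thesis
        using True by (simp add: f_def)
    next
      case False
      then have "t \<in> S"
        using t sub by auto
      have "(dxn S j u \<longlongrightarrow> dxn S j u t) (at t within S)"
        by (rule solves_on_dxn_tendsto [OF S sol a b4 \<open>t \<in> S\<close> that])
      then have "(dxn S j u \<longlongrightarrow> dxn S j u t) (at t within {c<..x})"
        by (rule tendsto_within_subset) (rule sub)
      moreover have "at t within {c<..x} = at t within {c..x}"
        by (rule at_within_nhd [of _ "{c<..}"]) (use False t in auto)
      ultimately have "(dxn S j u \<longlongrightarrow> dxn S j u t) (at t within {c..x})"
        by simp
      then have "(f j \<longlongrightarrow> dxn S j u t) (at t within {c..x})"
      proof (rule Lim_transform_eventually)
        have "eventually (\<lambda>y. y \<in> {c<..}) (nhds t)"
          by (rule eventually_nhds_in_open) (use False t in auto)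
        then show "eventually (\<lambda>y. dxn S j u y = f j y) (at t within {c..x})"
          unfolding eventually_at_filter by (rule eventually_mono) (auto simp: f_def)
      qed
      then show ?thesis
        using False by (simp add: f_def)
    qed
  qed
  have "f k x = dxn S k u x"
  proof (cases "x = c")
    case True
    then have "c \<in> S"
      using \<open>x \<in> S\<close> by simp
    have "(dxn S k u \<longlongrightarrow> dxn S k u c) (at_right c)"
      by (rule solves_on_dxn_tendsto_start [OF S sol a b4 \<open>c \<in> S\<close> \<open>k < 4\<close>])
    then have "dxn S k u c = B k"
      using B [OF \<open>k < 4\<close>] by (rule tendsto_unique [rotated]) simp
    then show ?thesis
      using True by (simp add: f_def)
  qed (simp add: f_def)
  moreover have "cmod \<tau> ^ 3 * cmod (\<tau> ^ 3 * f k x - \<tau> ^ k * unperturbed \<tau> (\<lambda>j. f j c) k (\<tau> * of_real (x - c)))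
       \<le> 2 * P * data_size (cmod \<tau>) (\<lambda>j. f j c) * (cmod \<tau> ^ k * exp (cmod \<tau> * (x - c)))"
  proof (rule perturbation_estimate [where p = "\<lambda>t. of_real (q t / b ^ 4)"])
    show "c \<le> x" "x - c \<le> 1"
      using unit_interval_at_bounds [OF S \<open>x \<in> S\<close>] by auto
    show "continuous_on {c..x} (f j)" if "j < 4" for j
      by (rule cont [OF that])
    fix t assume t: "c < t" "t < x"
    with sub have "t \<in> S"
      by auto
    have ft: "f j t = dxn S j u t" for j
      using t by (simp add: f_def)
    show "(f j has_vector_derivative f (Suc j) t) (at t)" if "j < 3" for j
      unfolding ft by (rule f_at [OF D1 [OF \<open>t \<in> S\<close> that] t])
    have "(s ^ 4 - of_real (q t)) / of_real (b ^ 4) = \<tau> ^ 4 - of_real (q t / b ^ 4)"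
      by (simp add: \<tau> power_divide diff_divide_distrib)
    then show "(f 3 has_vector_derivative (\<tau> ^ 4 - of_real (q t / b ^ 4)) * f 0 t) (at t)"
      using f_at [OF D2 [OF \<open>t \<in> S\<close>] t] by (simp add: ft)
    show "cmod (of_real (q t / b ^ 4)) \<le> P"
      unfolding norm_of_real using q [OF \<open>t \<in> S\<close>] \<open>b \<noteq> 0\<close>
      by (simp add: abs_divide field_simps)
  qed (fact assms)+
  ultimately show ?thesis
    by (simp add: f_def cong: if_cong)
qed

text \<open>For large \<open>\<tau>\<close> the perturbation at most doubles the natural bound on the unperturbed solution.\<close>

lemma solution_bound:
  assumes S: "unit_interval_at c S"
    and sol: "solves_on S a q (s ^ 4) u"
    and a: "\<And>x. x \<in> S \<Longrightarrow> a x = b ^ 4" and "b \<noteq> 0"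
    and q: "\<And>x. x \<in> S \<Longrightarrow> \<bar>q x\<bar> \<le> b ^ 4 * P" and "0 \<le> P"
    and B: "\<And>j. j < 4 \<Longrightarrow> (dxn S j u \<longlongrightarrow> B j) (at_right c)"
    and \<tau>: "\<tau> = s / of_real b" "\<tau> \<noteq> 0" and large: "2 * P \<le> cmod \<tau> ^ 3"
    and "x \<in> S" and "k < 4"
  shows "cmod \<tau> ^ 3 * cmod (dxn S k u x) \<le> 2 * data_size (cmod \<tau>) B * (cmod \<tau> ^ k * exp (cmod \<tau> * (x - c)))"
proof -
  let ?T = "cmod \<tau>" and ?N = "data_size (cmod \<tau>) B"
  let ?U = "unperturbed \<tau> B k (\<tau> * of_real (x - c))"
  let ?e = "?T ^ k * exp (?T * (x - c))"
  have "0 < ?T"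
    using \<tau> by simp
  have "?T ^ 3 * cmod (\<tau> ^ 3 * dxn S k u x - \<tau> ^ k * ?U) \<le> 2 * P * (?N * ?e)"
    using solution_deviation [OF S sol a \<open>b \<noteq> 0\<close> q \<open>0 \<le> P\<close> B \<tau>(1) large \<open>x \<in> S\<close> \<open>k < 4\<close>]
    by (simp add: mult.assoc)
  also have "\<dots> \<le> ?T ^ 3 * (?N * ?e)"
    by (intro mult_right_mono large mult_nonneg_nonneg data_size_nonneg) auto
  finally have 1: "cmod (\<tau> ^ 3 * dxn S k u x - \<tau> ^ k * ?U) \<le> ?N * ?e"
    using \<open>0 < ?T\<close> by simp
  have "cmod ?U \<le> ?N * exp (?T * (x - c))"
    using norm_unperturbed_le [of \<tau> B k "\<tau> * of_real (x - c)"] unit_interval_at_bounds(1) [OF S \<open>x \<in> S\<close>]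
    by (simp add: norm_mult del: of_real_diff)
  then have "?T ^ k * cmod ?U \<le> ?T ^ k * (?N * exp (?T * (x - c)))"
    by (rule mult_left_mono) simp
  then have 2: "cmod (\<tau> ^ k * ?U) \<le> ?N * ?e"
    by (simp add: norm_mult norm_power mult_ac)
  have "cmod (\<tau> ^ 3 * dxn S k u x) \<le> 2 * ?N * ?e"
    using norm_triangle_sub [of "\<tau> ^ 3 * dxn S k u x" "\<tau> ^ k * ?U"] 1 2 by simp
  then show ?thesis
    by (simp add: norm_mult norm_power)
qed

text \<open>The perturbation is smaller than the natural size of the solution by three powers of \<open>\<tau>\<close>.\<close>

lemma solution_asymptotics:
  assumes S: "unit_interval_at c S"
    and sol: "solves_on S a q (s ^ 4) u"
    and a: "\<And>x. x \<in> S \<Longrightarrow> a x = b ^ 4" and "b \<noteq> 0"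
    and q: "\<And>x. x \<in> S \<Longrightarrow> \<bar>q x\<bar> \<le> b ^ 4 * P" and "0 \<le> P"
    and B: "\<And>j. j < 4 \<Longrightarrow> (dxn S j u \<longlongrightarrow> B j) (at_right c)"
    and \<tau>: "\<tau> = s / of_real b" "\<tau> \<noteq> 0" and large: "2 * P \<le> cmod \<tau> ^ 3"
    and "x \<in> S" and "k < 4"
  shows "cmod (dxn S k u x - \<tau> ^ k / \<tau> ^ 3 * unperturbed \<tau> B k (\<tau> * of_real (x - c)))
       \<le> 2 * P * data_size (cmod \<tau>) B * (cmod \<tau> ^ k * exp (cmod \<tau> * (x - c))) / cmod \<tau> ^ 6"
proof -
  let ?T = "cmod \<tau>" and ?U = "unperturbed \<tau> B k (\<tau> * of_real (x - c))"
  let ?M = "2 * P * data_size (cmod \<tau>) B * (cmod \<tau> ^ k * exp (cmod \<tau> * (x - c)))"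
  have "\<tau> ^ 3 * dxn S k u x - \<tau> ^ k * ?U = \<tau> ^ 3 * (dxn S k u x - \<tau> ^ k / \<tau> ^ 3 * ?U)"
    using \<tau> by (simp add: right_diff_distrib)
  then have "?T ^ 3 * (?T ^ 3 * cmod (dxn S k u x - \<tau> ^ k / \<tau> ^ 3 * ?U)) \<le> ?M"
    using solution_deviation [OF S sol a \<open>b \<noteq> 0\<close> q \<open>0 \<le> P\<close> B \<tau>(1) large \<open>x \<in> S\<close> \<open>k < 4\<close>]
    by (simp add: norm_mult norm_power)
  moreover have "?T ^ 3 * ?T ^ 3 = ?T ^ 6"
    by (simp flip: power_add)
  ultimately have "cmod (dxn S k u x - \<tau> ^ k / \<tau> ^ 3 * ?U) * ?T ^ 6 \<le> ?M"
    by (simp only: mult.assoc [symmetric]) (simp only: mult.commute)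
  then show ?thesis
    by (rule iffD2 [OF pos_le_divide_eq, rotated]) (use \<tau>(2) in simp)
qed

section \<open>One-sided limits\<close>

text \<open>Near \<open>p\<close> the limit bounds \<open>f\<close>; what remains of \<open>S\<close> is compact.\<close>

lemma bounded_on_punctured_compact:
  fixes f :: "real \<Rightarrow> real"
  assumes "continuous_on S f" and "compact (insert p S)" and lim: "(f \<longlongrightarrow> L) (at p within S)"
    and "p \<notin> S"
  obtains Q where "0 \<le> Q" and "\<And>x. x \<in> S \<Longrightarrow> \<bar>f x\<bar> \<le> Q"
proof -
  obtain e where "0 < e" and e: "\<And>x. x \<in> S \<Longrightarrow> x \<noteq> p \<Longrightarrow> dist x p < e \<Longrightarrow> dist (f x) L < 1"
    using tendstoD [OF lim, of 1] unfolding eventually_at by auto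
  have "insert p S - ball p e = S - ball p e"
    using \<open>0 < e\<close> by auto
  then have "compact (S - ball p e)"
    using compact_diff [OF assms(2), of "ball p e"] by simp
  then have "bounded (f ` (S - ball p e))"
    by (intro compact_imp_bounded compact_continuous_image continuous_on_subset [OF assms(1)]) auto
  then obtain K where "\<forall>y\<in>f ` (S - ball p e). norm y \<le> K"
    unfolding bounded_iff by blast
  then have K: "\<bar>f x\<bar> \<le> K" if "x \<in> S - ball p e" for x
    using that by auto
  show thesis
  proof (rule that [of "max (\<bar>L\<bar> + 1) K"])
    show "\<bar>f x\<bar> \<le> max (\<bar>L\<bar> + 1) K" if "x \<in> S" for x
    proof (cases "x \<in> ball p e")
      case True
      then have "dist (f x) L < 1"
        using e [OF that] that \<open>p \<notin> S\<close> by (auto simp: dist_commute)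
      then show ?thesis
        by (auto simp: dist_real_def)
    next
      case False
      then show ?thesis
        using K [of x] that by simp
    qed
  qed auto
qed

text \<open>A Lipschitz function is uniformly continuous and so extends to the missing end point. This is
  needed because \<open>left_value\<close> carries information only where the limit exists.\<close>

lemma tendsto_at_left_if_bounded_derivative:
  fixes f :: "real \<Rightarrow> complex"
  assumes deriv: "\<And>x. x \<in> I_left \<Longrightarrow> (f has_vector_derivative f' x) (at x within I_left)"
    and bound: "\<And>x. x \<in> I_left \<Longrightarrow> cmod (f' x) \<le> M"
  shows "(f \<longlongrightarrow> Lim (at_left 0) f) (at_left 0)"
proof -
  have "0 \<le> M"
    using order_trans [OF norm_ge_zero bound [of "-1"]] by simp
  have "M-lipschitz_on I_left f"
  proof (rule lipschitz_onI)
    fix x y assume xy: "x \<in> I_left" "y \<in> I_left"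
    have "norm (f x - f y) \<le> M * norm (x - y)"
    proof (rule differentiable_bound [OF _ deriv [unfolded has_vector_derivative_def] _ xy])
      show "convex I_left"
        by simp
      show "onorm (\<lambda>h. h *\<^sub>R f' x) \<le> M" if "x \<in> I_left" for x
      proof (rule onorm_le)
        fix h :: real
        show "norm (h *\<^sub>R f' x) \<le> M * norm h"
          using mult_right_mono [OF bound [OF that] norm_ge_zero [of h]] by (simp add: mult.commute)
      qed
    qed
    then show "dist (f x) (f y) \<le> M * dist x y"
      by (simp add: dist_norm)
  qed (fact \<open>0 \<le> M\<close>)
  then have "uniformly_continuous_on I_left f"
    by (rule lipschitz_on_uniformly_continuous)
  moreover have "(0::real) \<in> closure I_left"
    by simp
  ultimately obtain l where "(f \<longlongrightarrow> l) (at 0 within I_left)"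
    by (rule uniformly_continuous_on_extension_at_closure)
  moreover have "at (0::real) within I_left = at_left 0"
    by (rule at_within_nhd [of _ "{-1<..}"]) auto
  ultimately have "(f \<longlongrightarrow> l) (at_left 0)"
    by simp
  then show ?thesis
    using tendsto_Lim by (metis trivial_limit_at_left_real)
qed

text \<open>Bounds pass to the limit at \<open>0\<close> once it exists. Existence for the \<open>k\<close>-th derivative follows from
  the bound on the next one, which for \<open>k = 3\<close> comes from the differential equation.\<close>

lemma left_value_bound:
  assumes sol: "solves_on I_left a q (s ^ 4) u"
    and a: "\<And>x. x \<in> I_left \<Longrightarrow> a x = b ^ 4" and "b \<noteq> 0"
    and q: "\<And>x. x \<in> I_left \<Longrightarrow> \<bar>q x\<bar> \<le> b ^ 4 * P" and "0 \<le> P"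
    and B: "\<And>j. j < 4 \<Longrightarrow> (dxn I_left j u \<longlongrightarrow> B j) (at_right (-1))"
    and \<tau>: "\<tau> = s / of_real b" "\<tau> \<noteq> 0" and large: "2 * P \<le> cmod \<tau> ^ 3"
    and "k < 4"
  shows "cmod \<tau> ^ 3 * cmod (left_value k u) \<le> 2 * data_size (cmod \<tau>) B * (cmod \<tau> ^ k * exp (cmod \<tau>))"
proof -
  let ?T = "cmod \<tau>" and ?N = "data_size (cmod \<tau>) B"
  have "0 < ?T"
    using \<tau> by simp
  have bound: "cmod (dxn I_left j u x) \<le> 2 * ?N * (?T ^ j * exp ?T) / ?T ^ 3" if "x \<in> I_left" "j < 4" for x j
  proof -
    have "?T ^ 3 * cmod (dxn I_left j u x) \<le> 2 * ?N * (?T ^ j * exp (?T * (x - (-1))))"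
      by (rule solution_bound [OF unit_interval_at_I_left sol a \<open>b \<noteq> 0\<close> q \<open>0 \<le> P\<close> B \<tau> large that])
    also have "\<dots> \<le> 2 * ?N * (?T ^ j * exp (?T * 1))"
    proof -
      have "?T * (x - (-1)) \<le> ?T * 1"
        by (rule mult_left_mono) (use that(1) in auto)
      then show ?thesis
        by (intro mult_left_mono) (auto simp: data_size_nonneg)
    qed
    finally show ?thesis
      using \<open>0 < ?T\<close> by (simp add: pos_le_divide_eq mult.commute)
  qed
  have b4: "b ^ 4 \<noteq> 0"
    using \<open>b \<noteq> 0\<close> by simp
  note D = solves_on_derivatives [OF unit_interval_at_I_left sol a b4]
  have "(dxn I_left k u \<longlongrightarrow> left_value k u) (at_left 0)"
  proof (cases "k = 3")
    case False
    then have "k < 3"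
      using \<open>k < 4\<close> by simp
    show ?thesis
      unfolding left_value_def
      by (rule tendsto_at_left_if_bounded_derivative [where f' = "dxn I_left (Suc k) u", OF D(1) bound])
        (use \<open>k < 3\<close> in auto)
  next
    case True
    let ?C = "(cmod s ^ 4 + b ^ 4 * P) / b ^ 4"
    have "cmod ((s ^ 4 - of_real (q x)) / of_real (b ^ 4) * u x) \<le> ?C * (2 * ?N * (?T ^ 0 * exp ?T) / ?T ^ 3)"
      if "x \<in> I_left" for x
    proof -
      have "cmod (s ^ 4 - of_real (q x)) \<le> cmod s ^ 4 + b ^ 4 * P"
        using norm_triangle_ineq4 [of "s ^ 4" "of_real (q x)"] q [OF that] by (simp add: norm_power)
      then have "cmod ((s ^ 4 - of_real (q x)) / of_real (b ^ 4)) \<le> ?C"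
        by (simp add: norm_divide norm_power divide_right_mono)
      then show ?thesis
        unfolding norm_mult [of _ "u x"] using bound [OF that, of 0] \<open>0 \<le> P\<close> by (intro mult_mono) auto
    qed
    then show ?thesis
      unfolding left_value_def True
      by (intro tendsto_at_left_if_bounded_derivative [OF D(2)])
  qed
  moreover have "eventually (\<lambda>x. x \<in> I_left) (at_left (0::real))"
    using eventually_at_left_real [of "-1" 0] by (rule eventually_mono) auto
  then have "eventually (\<lambda>x. cmod (dxn I_left k u x) \<le> 2 * ?N * (?T ^ k * exp ?T) / ?T ^ 3) (at_left 0)"
    by (rule eventually_mono) (use bound \<open>k < 4\<close> in auto)
  ultimately have "cmod (left_value k u) \<le> 2 * ?N * (?T ^ k * exp ?T) / ?T ^ 3"
    by (intro Lim_norm_ubound [of "at_left 0"]) auto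
  then show ?thesis
    using \<open>0 < ?T\<close> by (simp add: pos_le_divide_eq mult.commute)
qed

section \<open>Trigonometric and exponential functions\<close>

lemma dxn_trig:
  fixes \<tau> :: complex
  assumes "unit_interval_at c S" and "x \<in> S"
  defines "Z \<equiv> \<tau> * of_real (x - c)"
  shows "dxn S k (\<lambda>y. cos (\<tau> * of_real (y - c))) x = \<tau> ^ k * (krylov k Z - krylov (k + 2) Z)"
    and "dxn S k (\<lambda>y. sin (\<tau> * of_real (y - c))) x = \<tau> ^ k * (krylov (k + 3) Z - krylov (k + 1) Z)"
    and "dxn S k (\<lambda>y. exp (\<tau> * of_real (y - c)) + exp (- (\<tau> * of_real (y - c)))) x
      = 2 * \<tau> ^ k * (krylov k Z + krylov (k + 2) Z)"
    and "dxn S k (\<lambda>y. exp (\<tau> * of_real (y - c)) - exp (- (\<tau> * of_real (y - c)))) x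
      = 2 * \<tau> ^ k * (krylov (k + 1) Z + krylov (k + 3) Z)"
  unfolding cos_eq_krylov sin_eq_krylov exp_plus_eq_krylov exp_minus_eq_krylov
  using dxn_krylov_combination [OF assms(1,2), of k 1 0 \<tau> "- 1" 2]
    dxn_krylov_combination [OF assms(1,2), of k 1 3 \<tau> "- 1" 1]
    dxn_krylov_combination [OF assms(1,2), of k 2 0 \<tau> 2 2]
    dxn_krylov_combination [OF assms(1,2), of k 2 1 \<tau> 2 3]
  by (simp_all add: Z_def add.commute [of 2 k] add.commute [of 3 k] add.commute [of 1 k] distrib_left)

lemma unperturbed_expand:
  "unperturbed \<tau> B k z = \<tau> ^ 3 * B 0 * krylov (k + 4) z + \<tau> ^ 2 * B 1 * krylov (k + 3) z
    + \<tau> * B 2 * krylov (k + 2) z + B 3 * krylov (k + 1) z"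
  by (simp add: unperturbed_def sum_lessThan_4 add.commute [of 3 k])

lemma data_size_expand:
  "data_size r B = r ^ 3 * cmod (B 0) + r ^ 2 * cmod (B 1) + r * cmod (B 2) + cmod (B 3)"
  by (simp add: data_size_def sum_lessThan_4)

text \<open>The four explicit terms are the part of the unperturbed solution produced by the jumps
  \<open>\<lambda> \<delta>1 u'(0)\<close> and \<open>\<lambda> \<delta>2 u(0)\<close> of the second and third derivatives; the sign reflects that the
  jumps are subtracted.\<close>

lemma right_main_term:
  fixes a2 :: real
  assumes "x \<in> I_right" and "a2 \<noteq> 0" and "s \<noteq> 0"
  defines "\<tau> \<equiv> s / of_real a2"
  shows "of_real a2 ^ 2 * s ^ 2 * d1 * A1 / 2 * dxn I_right k (\<lambda>y::real. cos (s * of_real y / of_real a2)) x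
      + of_real a2 ^ 3 * s * d0 * A0 / 2 * dxn I_right k (\<lambda>y::real. sin (s * of_real y / of_real a2)) x
      - of_real a2 ^ 2 * s ^ 2 * d1 * A1 / 4
        * dxn I_right k (\<lambda>y::real. exp (s * of_real y / of_real a2) + exp (- (s * of_real y / of_real a2))) x
      - of_real a2 ^ 3 * s * d0 * A0 / 4
        * dxn I_right k (\<lambda>y::real. exp (s * of_real y / of_real a2) - exp (- (s * of_real y / of_real a2))) x
    = - (\<tau> ^ k / \<tau> ^ 3 * unperturbed \<tau> ((\<lambda>j. 0)(2 := s ^ 4 * d1 * A1, 3 := s ^ 4 * d0 * A0)) k (\<tau> * of_real x))"
proof -
  have "\<tau> \<noteq> 0" and s: "s = of_real a2 * \<tau>"
    using assms by auto
  have arg: "s * of_real y / of_real a2 = \<tau> * of_real (y - 0)" for y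
    by (simp add: \<tau>_def)
  show ?thesis
    unfolding arg dxn_trig [OF unit_interval_at_I_right \<open>x \<in> I_right\<close>]
    unfolding s unperturbed_expand
    using \<open>\<tau> \<noteq> 0\<close> by (simp add: field_simps power_mult_distrib) (simp add: eval_nat_numeral algebra_simps)
qed

text \<open>The explicit terms are the part of the unperturbed solution produced by the initial
  slope \<open>d\<close>.\<close>

lemma left_main_term:
  fixes a1 :: real
  assumes "x \<in> I_left" and "a1 \<noteq> 0" and "s \<noteq> 0"
  defines "\<tau> \<equiv> s / of_real a1"
  shows "d * of_real a1 / (2 * s) * dxn I_left k (\<lambda>y::real. sin (s * of_real (y + 1) / of_real a1)) x
      + d * of_real a1 / (4 * s)
        * dxn I_left k (\<lambda>y::real. exp (s * of_real (y + 1) / of_real a1) - exp (- (s * of_real (y + 1) / of_real a1))) x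
    = \<tau> ^ k / \<tau> * d * krylov (k + 3) (\<tau> * of_real (x + 1))"
proof -
  have "\<tau> \<noteq> 0" and s: "s = of_real a1 * \<tau>"
    using assms by auto
  have arg: "s * of_real (y + 1) / of_real a1 = \<tau> * of_real (y - (-1))" for y
    by (simp add: \<tau>_def)
  show ?thesis
    unfolding arg dxn_trig [OF unit_interval_at_I_left \<open>x \<in> I_left\<close>]
    unfolding s using \<open>\<tau> \<noteq> 0\<close> \<open>a1 \<noteq> 0\<close> by (simp add: field_simps)
qed

section \<open>Uniform estimates\<close>

lemma bigo_uniformI:
  assumes "\<And>s x. R \<le> cmod s \<Longrightarrow> x \<in> S \<Longrightarrow> cmod (f s x) \<le> C * g s x"
  shows "(\<lambda>(s, x). cmod (f s x)) \<in> O[unif_at_infinity S](\<lambda>(s, x). g s x :: real)"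
proof (rule bigoI [where c = "\<bar>C\<bar>"])
  have "eventually (\<lambda>s. R \<le> cmod s) at_infinity"
    by (auto simp: eventually_at_infinity)
  moreover have "eventually (\<lambda>x. x \<in> S) (principal S)"
    by (simp add: eventually_principal)
  ultimately have "eventually (\<lambda>p. R \<le> cmod (fst p) \<and> snd p \<in> S) (unif_at_infinity S)"
    by (rule eventually_prodI)
  then show "eventually (\<lambda>p. norm (case p of (s, x) \<Rightarrow> cmod (f s x)) \<le> \<bar>C\<bar> * norm (case p of (s, x) \<Rightarrow> g s x)) (unif_at_infinity S)"
  proof (rule eventually_mono)
    fix p assume p: "R \<le> cmod (fst p) \<and> snd p \<in> S"
    have "cmod (f (fst p) (snd p)) \<le> C * g (fst p) (snd p)"
      using assms p by blast
    also have "\<dots> \<le> \<bar>C\<bar> * \<bar>g (fst p) (snd p)\<bar>"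
      by (simp add: abs_le_D1 flip: abs_mult)
    finally show "norm (case p of (s, x) \<Rightarrow> cmod (f s x)) \<le> \<bar>C\<bar> * norm (case p of (s, x) \<Rightarrow> g s x)"
      by (simp add: case_prod_unfold)
  qed
qed

lemma le_power_int_diff:
  fixes r :: real
  assumes "0 < r" and "r ^ n * y \<le> M * (r ^ k * e)"
  shows "y \<le> M * (r powi (int k - int n) * e)"
proof -
  have "r powi (int k - int n) = r ^ k / r ^ n"
    using \<open>0 < r\<close> by (simp add: power_int_diff)
  moreover have "y \<le> M * (r ^ k * e) / r ^ n"
    by (rule iffD2 [OF pos_le_divide_eq]) (use assms in \<open>simp_all add: mult.commute\<close>)
  ultimately show ?thesis
    by simp
qed

text \<open>One linear condition on \<open>\<bar>s\<bar>\<close> provides both thresholds used in the estimates.\<close>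

lemma large_parameter:
  fixes b P r :: real
  assumes "0 < b" and "0 \<le> P" and "b * (1 + 2 * P) \<le> r"
  shows "1 \<le> r / b" and "2 * P \<le> (r / b) ^ 3"
proof -
  have *: "1 + 2 * P \<le> r / b"
    using assms by (simp add: pos_le_divide_eq mult.commute)
  then show "1 \<le> r / b"
    using \<open>0 \<le> P\<close> by simp
  then have "r / b \<le> (r / b) ^ 3"
    by (rule self_le_power) simp
  then show "2 * P \<le> (r / b) ^ 3"
    using * by simp
qed

text \<open>A solution on the left half whose initial data have size \<open>O(\<bar>\<tau>\<bar>\<^sup>2)\<close> grows at the rate
  \<open>\<bar>s\<bar> ^ (k - 1)\<close>, up to and including its limits at \<open>0\<close>. Negative powers are avoided by
  multiplying with \<open>\<bar>s\<bar>\<close>.\<close>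

lemma left_growth:
  fixes b :: real
  assumes sol: "solves_on I_left a q (s ^ 4) u"
    and a: "\<And>x. x \<in> I_left \<Longrightarrow> a x = b ^ 4" and "0 < b"
    and q: "\<And>x. x \<in> I_left \<Longrightarrow> \<bar>q x\<bar> \<le> b ^ 4 * P" and "0 \<le> P"
    and large: "b * (1 + 2 * P) \<le> cmod s"
    and size: "data_size (cmod s / b) (\<lambda>j. dxn I_left j u (- 1)) \<le> C * (cmod s / b) ^ 2"
    and "k < 4"
  shows "x \<in> I_left \<Longrightarrow> cmod s * cmod (dxn I_left k u x) \<le> 2 * C * b / b ^ k * (cmod s ^ k * exp (cmod s * ((x + 1) / b)))"
    and "cmod s * cmod (left_value k u) \<le> 2 * C * b / b ^ k * (cmod s ^ k * exp (cmod s / b))"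
proof -
  define \<tau> where "\<tau> = s / of_real b"
  have T: "cmod \<tau> = cmod s / b"
    using \<open>0 < b\<close> by (simp add: \<tau>_def norm_divide)
  have one: "1 \<le> cmod \<tau>" and large': "2 * P \<le> cmod \<tau> ^ 3"
    unfolding T by (rule large_parameter [OF \<open>0 < b\<close> \<open>0 \<le> P\<close> large])+
  then have "\<tau> \<noteq> 0" "b \<noteq> 0" "b ^ 4 \<noteq> 0"
    using \<open>0 < b\<close> by auto
  let ?N = "data_size (cmod \<tau>) (\<lambda>j. dxn I_left j u (- 1))"
  have B: "(dxn I_left j u \<longlongrightarrow> dxn I_left j u (- 1)) (at_right (- 1))" if "j < 4" for j
    by (rule solves_on_dxn_tendsto_start [OF unit_interval_at_I_left sol a \<open>b ^ 4 \<noteq> 0\<close> _ that]) auto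
  have rescale: "cmod s * y \<le> 2 * C * b / b ^ k * (cmod s ^ k * e)"
    if "cmod \<tau> ^ 3 * y \<le> 2 * ?N * (cmod \<tau> ^ k * e)" "0 \<le> e" for y e
  proof -
    have "cmod \<tau> ^ 3 * y \<le> 2 * (C * cmod \<tau> ^ 2) * (cmod \<tau> ^ k * e)"
      by (rule order_trans [OF that(1)], intro mult_right_mono mult_left_mono) (use size that(2) \<open>0 < b\<close> in \<open>auto simp: T\<close>)
    then have "cmod \<tau> ^ 2 * (cmod \<tau> * y) \<le> cmod \<tau> ^ 2 * (2 * C * (cmod \<tau> ^ k * e))"
      by (simp add: eval_nat_numeral mult_ac)
    then have "cmod \<tau> * y \<le> 2 * C * (cmod \<tau> ^ k * e)"
      using \<open>\<tau> \<noteq> 0\<close> by simp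
    then have "b * (cmod \<tau> * y) \<le> b * (2 * C * (cmod \<tau> ^ k * e))"
      using \<open>0 < b\<close> by (intro mult_left_mono) auto
    then show ?thesis
      using \<open>0 < b\<close> by (simp add: T power_divide mult_ac)
  qed
  show "cmod s * cmod (dxn I_left k u x) \<le> 2 * C * b / b ^ k * (cmod s ^ k * exp (cmod s * ((x + 1) / b)))"
    if "x \<in> I_left"
  proof (rule rescale)
    show "cmod \<tau> ^ 3 * cmod (dxn I_left k u x) \<le> 2 * ?N * (cmod \<tau> ^ k * exp (cmod s * ((x + 1) / b)))"
      using solution_bound [OF unit_interval_at_I_left sol a \<open>b \<noteq> 0\<close> q \<open>0 \<le> P\<close> B \<tau>_def \<open>\<tau> \<noteq> 0\<close> large' that \<open>k < 4\<close>]
      by (simp add: T)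
  qed simp
  show "cmod s * cmod (left_value k u) \<le> 2 * C * b / b ^ k * (cmod s ^ k * exp (cmod s / b))"
  proof (rule rescale)
    show "cmod \<tau> ^ 3 * cmod (left_value k u) \<le> 2 * ?N * (cmod \<tau> ^ k * exp (cmod s / b))"
      using left_value_bound [OF sol a \<open>b \<noteq> 0\<close> q \<open>0 \<le> P\<close> B \<tau>_def \<open>\<tau> \<noteq> 0\<close> large' \<open>k < 4\<close>]
      by (simp add: T)
  qed simp
qed

lemma unperturbed_diff:
  "unperturbed \<tau> (\<lambda>j. A j - D j) k z = unperturbed \<tau> A k z - unperturbed \<tau> D k z"
  by (simp add: unperturbed_expand algebra_simps)

lemma data_size_diff_le:
  assumes "0 \<le> r"
  shows "data_size r (\<lambda>j. A j - D j) \<le> data_size r A + data_size r D"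
  unfolding data_size_def sum.distrib [symmetric] distrib_left [symmetric]
  by (intro sum_mono mult_left_mono norm_triangle_ineq4) (use assms in auto)

text \<open>The data on the right split as \<open>B = A - D\<close>, with \<open>A\<close> the continuous continuation and \<open>D\<close> the
  jumps. The unperturbed solution with data \<open>D\<close> is the main term. Exponential factors aside, the data \<open>A\<close> contribute
  \<open>\<bar>\<tau>\<bar> ^ (k - 3) O(\<bar>s\<bar>\<^sup>2)\<close>. The jumps may raise the size of \<open>B\<close> to \<open>O(\<bar>s\<bar>\<^sup>5)\<close>, but the perturbation
  error gains \<open>\<bar>\<tau>\<bar> ^ (k - 6)\<close>, so that both errors are \<open>O(\<bar>s\<bar> ^ (k - 1))\<close>.\<close>

lemma right_estimate:
  fixes b \<delta>1 \<delta>2 :: real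
  assumes sol: "solves_on I_right a q (s ^ 4) v"
    and a: "\<And>x. x \<in> I_right \<Longrightarrow> a x = b ^ 4" and "0 < b"
    and q: "\<And>x. x \<in> I_right \<Longrightarrow> \<bar>q x\<bar> \<le> b ^ 4 * P" and "0 \<le> P"
    and large: "b * (1 + 2 * P) \<le> cmod s" "1 \<le> cmod s"
    and trans: "transmission \<delta>1 \<delta>2 (s ^ 4) u v"
    and A: "\<And>j. j < 4 \<Longrightarrow> cmod s * cmod (left_value j u) \<le> C j * (cmod s ^ j * E)"
    and C: "\<And>j. 0 \<le> C j" and "0 \<le> E"
    and "x \<in> I_right" and "k < 4"
  defines "\<tau> \<equiv> s / of_real b"
    and "D \<equiv> (\<lambda>j. 0)(2 := s ^ 4 * of_real \<delta>1 * left_value 1 u, 3 := s ^ 4 * of_real \<delta>2 * left_value 0 u)"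
    and "c0 \<equiv> C 0 / b ^ 3 + C 1 / b ^ 2 + C 2 / b + C 3"
    and "c1 \<equiv> \<bar>\<delta>1\<bar> * C 1 / b + \<bar>\<delta>2\<bar> * C 0"
  shows "cmod s * cmod (dxn I_right k v x - - (\<tau> ^ k / \<tau> ^ 3 * unperturbed \<tau> D k (\<tau> * of_real x)))
     \<le> (b ^ 3 * c0 + 2 * P * b ^ 6 * (c0 + c1)) / b ^ k * (cmod s ^ k * (E * exp (cmod s * (x / b))))"
proof -
  let ?A = "\<lambda>j. left_value j u" and ?r = "cmod s"
  define B where "B = (\<lambda>j. ?A j - D j)"
  define e where "e = exp (?r * (x / b))"
  have T: "cmod \<tau> = ?r / b"
    using \<open>0 < b\<close> by (simp add: \<tau>_def norm_divide)
  have one: "1 \<le> cmod \<tau>" and large': "2 * P \<le> cmod \<tau> ^ 3"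
    unfolding T by (rule large_parameter [OF \<open>0 < b\<close> \<open>0 \<le> P\<close> large(1)])+
  then have "\<tau> \<noteq> 0" "b \<noteq> 0" "0 < ?r"
    using \<open>0 < b\<close> large(2) by auto
  have c: "0 \<le> c0" "0 \<le> c1"
    using C \<open>0 < b\<close> by (auto simp: c0_def c1_def intro!: add_nonneg_nonneg)
  have lim: "(dxn I_right j v \<longlongrightarrow> B j) (at_right 0)" if "j < 4" for j
  proof -
    have "j = 0 \<or> j = 1 \<or> j = 2 \<or> j = 3"
      using that by auto
    then show ?thesis
      using trans by (auto simp: transmission_def B_def D_def mult.assoc)
  qed
  have sizeA: "?r * data_size (cmod \<tau>) ?A \<le> c0 * (?r ^ 3 * E)"
  proof -
    have "?r * data_size (cmod \<tau>) ?A = (?r / b) ^ 3 * (?r * cmod (?A 0)) + (?r / b) ^ 2 * (?r * cmod (?A 1))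
        + (?r / b) * (?r * cmod (?A 2)) + ?r * cmod (?A 3)"
      by (simp add: data_size_expand T algebra_simps)
    also have "\<dots> \<le> (?r / b) ^ 3 * (C 0 * (?r ^ 0 * E)) + (?r / b) ^ 2 * (C 1 * (?r ^ 1 * E))
        + (?r / b) * (C 2 * (?r ^ 2 * E)) + C 3 * (?r ^ 3 * E)"
      by (intro add_mono mult_left_mono A) (use \<open>0 < b\<close> in auto)
    also have "\<dots> = c0 * (?r ^ 3 * E)"
      using \<open>0 < b\<close> by (simp add: c0_def field_simps eval_nat_numeral)
    finally show ?thesis .
  qed
  have sizeD: "?r * data_size (cmod \<tau>) D \<le> c1 * (?r ^ 6 * E)"
  proof -
    have "?r * data_size (cmod \<tau>) D = ?r ^ 5 / b * \<bar>\<delta>1\<bar> * (?r * cmod (?A 1)) + ?r ^ 4 * \<bar>\<delta>2\<bar> * (?r * cmod (?A 0))"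
      by (simp add: data_size_expand T D_def norm_mult norm_power eval_nat_numeral algebra_simps)
    also have "\<dots> \<le> ?r ^ 5 / b * \<bar>\<delta>1\<bar> * (C 1 * (?r ^ 1 * E)) + ?r ^ 4 * \<bar>\<delta>2\<bar> * (C 0 * (?r ^ 0 * E))"
      by (intro add_mono mult_left_mono A) (use \<open>0 < b\<close> in auto)
    \<comment> \<open>The jump of the third derivative is two orders smaller; one power serves both.\<close>
    also have "\<dots> \<le> ?r ^ 5 / b * \<bar>\<delta>1\<bar> * (C 1 * (?r ^ 1 * E)) + ?r ^ 6 * \<bar>\<delta>2\<bar> * (C 0 * (?r ^ 0 * E))"
      by (intro add_mono mult_right_mono power_increasing) (use C large \<open>0 \<le> E\<close> in auto)
    also have "\<dots> = c1 * (?r ^ 6 * E)"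
      by (simp add: c1_def eval_nat_numeral algebra_simps)
    finally show ?thesis .
  qed
  have sizeB: "?r * data_size (cmod \<tau>) B \<le> (c0 + c1) * (?r ^ 6 * E)"
  proof -
    have "?r * data_size (cmod \<tau>) B \<le> ?r * (data_size (cmod \<tau>) ?A + data_size (cmod \<tau>) D)"
      unfolding B_def by (intro mult_left_mono data_size_diff_le) auto
    also have "\<dots> \<le> c0 * (?r ^ 3 * E) + c1 * (?r ^ 6 * E)"
      using sizeA sizeD by (simp add: distrib_left)
    also have "\<dots> \<le> c0 * (?r ^ 6 * E) + c1 * (?r ^ 6 * E)"
      by (intro add_mono mult_left_mono mult_right_mono power_increasing order_refl)
        (use c large \<open>0 \<le> E\<close> in auto)
    finally show ?thesis
      by (simp add: distrib_right)
  qed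
  let ?U = "\<lambda>F. \<tau> ^ k / \<tau> ^ 3 * unperturbed \<tau> F k (\<tau> * of_real x)"
  have "cmod (dxn I_right k v x - ?U B) \<le> 2 * P * data_size (cmod \<tau>) B * (cmod \<tau> ^ k * e) / cmod \<tau> ^ 6"
    using solution_asymptotics [OF unit_interval_at_I_right sol a \<open>b \<noteq> 0\<close> q \<open>0 \<le> P\<close> lim _ \<open>\<tau> \<noteq> 0\<close> large' \<open>x \<in> I_right\<close> \<open>k < 4\<close>]
    by (simp add: \<tau>_def [symmetric] e_def T)
  moreover have "cmod (?U ?A) \<le> cmod \<tau> ^ k / cmod \<tau> ^ 3 * (data_size (cmod \<tau>) ?A * e)"
  proof -
    have "cmod (unperturbed \<tau> ?A k (\<tau> * of_real x)) \<le> data_size (cmod \<tau>) ?A * e"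
      using norm_unperturbed_le [of \<tau> ?A k "\<tau> * of_real x"] \<open>x \<in> I_right\<close> by (simp add: norm_mult e_def T)
    then show ?thesis
      unfolding norm_mult [of "\<tau> ^ k / \<tau> ^ 3"] norm_divide norm_power by (rule mult_left_mono) auto
  qed
  moreover have "dxn I_right k v x - - ?U D = (dxn I_right k v x - ?U B) + ?U ?A"
    unfolding B_def unperturbed_diff by (simp add: right_diff_distrib)
  ultimately have "cmod (dxn I_right k v x - - ?U D)
      \<le> 2 * P * data_size (cmod \<tau>) B * (cmod \<tau> ^ k * e) / cmod \<tau> ^ 6
        + cmod \<tau> ^ k / cmod \<tau> ^ 3 * (data_size (cmod \<tau>) ?A * e)"
    by (simp only: norm_triangle_le add_mono)
  then have "?r * cmod (dxn I_right k v x - - ?U D)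
      \<le> ?r * (2 * P * data_size (cmod \<tau>) B * (cmod \<tau> ^ k * e) / cmod \<tau> ^ 6
        + cmod \<tau> ^ k / cmod \<tau> ^ 3 * (data_size (cmod \<tau>) ?A * e))"
    by (rule mult_left_mono) simp
  also have "\<dots> = 2 * P * (cmod \<tau> ^ k * e) / cmod \<tau> ^ 6 * (?r * data_size (cmod \<tau>) B)
        + cmod \<tau> ^ k / cmod \<tau> ^ 3 * e * (?r * data_size (cmod \<tau>) ?A)"
    by (simp add: distrib_left mult_ac)
  also have "\<dots> \<le> 2 * P * (cmod \<tau> ^ k * e) / cmod \<tau> ^ 6 * ((c0 + c1) * (?r ^ 6 * E))
        + cmod \<tau> ^ k / cmod \<tau> ^ 3 * e * (c0 * (?r ^ 3 * E))"
    by (intro add_mono mult_left_mono sizeA sizeB) (use \<open>0 \<le> P\<close> in \<open>auto simp: e_def\<close>)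
  also have "\<dots> = (b ^ 3 * c0 + 2 * P * b ^ 6 * (c0 + c1)) / b ^ k * (?r ^ k * (E * e))"
    using \<open>0 < b\<close> \<open>0 < ?r\<close> by (simp add: T power_divide field_simps)
  finally show ?thesis
    by (simp only: e_def)
qed

lemma right_remainder_bigo:
  fixes a1 a2 \<delta>1 \<delta>2 :: real and u v :: "complex \<Rightarrow> real \<Rightarrow> complex"
  assumes sol: "\<And>l. solves_on I_right a q l (v l)"
    and a: "\<And>x. x \<in> I_right \<Longrightarrow> a x = a2 ^ 4" and "0 < a1" and "0 < a2"
    and q: "\<And>x. x \<in> I_right \<Longrightarrow> \<bar>q x\<bar> \<le> Q" and "0 \<le> Q"
    and trans: "\<And>l. transmission \<delta>1 \<delta>2 l (u l) (v l)"
    and A: "\<And>j s. j < 4 \<Longrightarrow> R \<le> cmod s \<Longrightarrow>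
      cmod s * cmod (left_value j (u (s ^ 4))) \<le> C j * (cmod s ^ j * exp (cmod s / a1))"
    and C: "\<And>j. 0 \<le> C j"
    and "k < 4"
  shows "(\<lambda>(s::complex, x::real). cmod (dxn I_right k (v (s ^ 4)) x
            - (of_real a2 ^ 2 * s ^ 2 * of_real \<delta>1 * left_value 1 (u (s ^ 4)) / 2
                 * dxn I_right k (\<lambda>y::real. cos (s * of_real y / of_real a2)) x
               + of_real a2 ^ 3 * s * of_real \<delta>2 * left_value 0 (u (s ^ 4)) / 2
                 * dxn I_right k (\<lambda>y::real. sin (s * of_real y / of_real a2)) x
               - of_real a2 ^ 2 * s ^ 2 * of_real \<delta>1 * left_value 1 (u (s ^ 4)) / 4
                 * dxn I_right k (\<lambda>y::real. exp (s * of_real y / of_real a2) + exp (- (s * of_real y / of_real a2))) x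
               - of_real a2 ^ 3 * s * of_real \<delta>2 * left_value 0 (u (s ^ 4)) / 4
                 * dxn I_right k (\<lambda>y::real. exp (s * of_real y / of_real a2) - exp (- (s * of_real y / of_real a2))) x)))
         \<in> O[unif_at_infinity I_right](\<lambda>(s::complex, x::real). cmod s powi (int k - 1) * exp (cmod s * ((a1 * x + a2) / (a1 * a2))))"
proof -
  define P where "P = Q / a2 ^ 4"
  have "0 \<le> P"
    using \<open>0 \<le> Q\<close> by (simp add: P_def)
  have qP: "\<bar>q x\<bar> \<le> a2 ^ 4 * P" if "x \<in> I_right" for x
    using q [OF that] \<open>0 < a2\<close> by (simp add: P_def)
  define c0 where "c0 = C 0 / a2 ^ 3 + C 1 / a2 ^ 2 + C 2 / a2 + C 3"
  define c1 where "c1 = \<bar>\<delta>1\<bar> * C 1 / a2 + \<bar>\<delta>2\<bar> * C 0"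
  let ?M = "(a2 ^ 3 * c0 + 2 * P * a2 ^ 6 * (c0 + c1)) / a2 ^ k"
  show ?thesis
  proof (rule bigo_uniformI [where R = "max (max R 1) (a2 * (1 + 2 * P))" and C = ?M])
    fix s :: complex and x :: real
    assume s: "max (max R 1) (a2 * (1 + 2 * P)) \<le> cmod s" and x: "x \<in> I_right"
    let ?m = "of_real a2 ^ 2 * s ^ 2 * of_real \<delta>1 * left_value 1 (u (s ^ 4)) / 2
                 * dxn I_right k (\<lambda>y::real. cos (s * of_real y / of_real a2)) x
               + of_real a2 ^ 3 * s * of_real \<delta>2 * left_value 0 (u (s ^ 4)) / 2
                 * dxn I_right k (\<lambda>y::real. sin (s * of_real y / of_real a2)) x
               - of_real a2 ^ 2 * s ^ 2 * of_real \<delta>1 * left_value 1 (u (s ^ 4)) / 4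
                 * dxn I_right k (\<lambda>y::real. exp (s * of_real y / of_real a2) + exp (- (s * of_real y / of_real a2))) x
               - of_real a2 ^ 3 * s * of_real \<delta>2 * left_value 0 (u (s ^ 4)) / 4
                 * dxn I_right k (\<lambda>y::real. exp (s * of_real y / of_real a2) - exp (- (s * of_real y / of_real a2))) x"
    have "s \<noteq> 0" "a2 \<noteq> 0"
      using s \<open>0 < a2\<close> by auto
    have "exp (cmod s / a1) * exp (cmod s * (x / a2)) = exp (cmod s * ((a1 * x + a2) / (a1 * a2)))"
      using \<open>0 < a1\<close> \<open>0 < a2\<close> by (simp add: field_simps flip: exp_add)
    moreover have "cmod s * cmod (dxn I_right k (v (s ^ 4)) x - ?m)
        \<le> ?M * (cmod s ^ k * (exp (cmod s / a1) * exp (cmod s * (x / a2))))"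
      unfolding right_main_term [OF x \<open>a2 \<noteq> 0\<close> \<open>s \<noteq> 0\<close>] c0_def c1_def
      by (rule right_estimate [OF sol a \<open>0 < a2\<close> qP \<open>0 \<le> P\<close> _ _ trans A C _ x \<open>k < 4\<close>])
        (use s in auto)
    ultimately have "cmod s ^ 1 * cmod (dxn I_right k (v (s ^ 4)) x - ?m)
        \<le> ?M * (cmod s ^ k * exp (cmod s * ((a1 * x + a2) / (a1 * a2))))"
      by (simp only: power_one_right)
    then show "cmod (dxn I_right k (v (s ^ 4)) x - ?m)
        \<le> ?M * (cmod s powi (int k - 1) * exp (cmod s * ((a1 * x + a2) / (a1 * a2))))"
      using le_power_int_diff [of "cmod s" 1] \<open>s \<noteq> 0\<close> by (simp only: zero_less_norm_iff of_nat_1 not_False_eq_True)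
  qed
qed

lemma power_int_mono_bigo:
  assumes "m \<le> n"
  shows "(\<lambda>(s, x). cmod s powi m * exp (cmod s * h x))
    \<in> O[unif_at_infinity S](\<lambda>(s, x). cmod s powi n * exp (cmod s * h x))"
proof -
  have eq: "cmod (of_real (cmod s powi m * exp (cmod s * h x))) = cmod s powi m * exp (cmod s * h x)" for s :: complex and x
    unfolding norm_of_real by simp
  have "(\<lambda>(s, x). cmod (of_real (cmod s powi m * exp (cmod s * h x))))
    \<in> O[unif_at_infinity S](\<lambda>(s, x). cmod s powi n * exp (cmod s * h x))"
  proof (rule bigo_uniformI [where R = 1 and C = 1])
    fix s :: complex and x :: real
    assume "1 \<le> cmod s"
    then have "cmod s powi m \<le> cmod s powi n"
      by (intro power_int_increasing assms) auto
    then show "cmod (of_real (cmod s powi m * exp (cmod s * h x))) \<le> 1 * (cmod s powi n * exp (cmod s * h x))"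
      unfolding eq by simp
  qed
  then show ?thesis
    unfolding eq .
qed

lemma left_growth_bigo:
  fixes b :: real and u :: "complex \<Rightarrow> real \<Rightarrow> complex"
  assumes sol: "\<And>l. solves_on I_left a q l (u l)"
    and a: "\<And>x. x \<in> I_left \<Longrightarrow> a x = b ^ 4" and "0 < b"
    and q: "\<And>x. x \<in> I_left \<Longrightarrow> \<bar>q x\<bar> \<le> b ^ 4 * P" and "0 \<le> P"
    and size: "\<And>s. 1 \<le> cmod s / b \<Longrightarrow>
      data_size (cmod s / b) (\<lambda>j. dxn I_left j (u (s ^ 4)) (- 1)) \<le> C * (cmod s / b) ^ 2"
    and "k < 4"
  shows "(\<lambda>(s, x). cmod (dxn I_left k (u (s ^ 4)) x))
    \<in> O[unif_at_infinity I_left](\<lambda>(s, x). cmod s powi (int k - 1) * exp (cmod s * ((x + 1) / b)))"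
proof (rule bigo_uniformI [where R = "b * (1 + 2 * P)" and C = "2 * C * b / b ^ k"])
  fix s :: complex and x :: real
  assume s: "b * (1 + 2 * P) \<le> cmod s" and x: "x \<in> I_left"
  have "1 \<le> cmod s / b"
    by (rule large_parameter [OF \<open>0 < b\<close> \<open>0 \<le> P\<close> s])
  then have "0 < cmod s"
    by auto
  moreover have "cmod s ^ 1 * cmod (dxn I_left k (u (s ^ 4)) x)
      \<le> 2 * C * b / b ^ k * (cmod s ^ k * exp (cmod s * ((x + 1) / b)))"
    using left_growth(1) [OF sol a \<open>0 < b\<close> q \<open>0 \<le> P\<close> s size [OF \<open>1 \<le> cmod s / b\<close>] \<open>k < 4\<close> x]
    by (simp only: power_one_right)
  ultimately show "cmod (dxn I_left k (u (s ^ 4)) x)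
      \<le> 2 * C * b / b ^ k * (cmod s powi (int k - 1) * exp (cmod s * ((x + 1) / b)))"
    using le_power_int_diff [of "cmod s" 1] by (simp only: of_nat_1)
qed

text \<open>The initial slope \<open>\<beta>2\<close> yields the leading term. The second derivative \<open>- \<beta>1\<close> is one order
  smaller and is part of the remainder, as is the perturbation error.\<close>

lemma left_leading_term_bigo:
  fixes a1 \<beta>1 \<beta>2 :: real and u :: "complex \<Rightarrow> real \<Rightarrow> complex"
  assumes sol: "\<And>l. solves_on I_left a q l (u l)"
    and a: "\<And>x. x \<in> I_left \<Longrightarrow> a x = a1 ^ 4" and "0 < a1"
    and q: "\<And>x. x \<in> I_left \<Longrightarrow> \<bar>q x\<bar> \<le> a1 ^ 4 * P" and "0 \<le> P"
    and init: "\<And>l. dxn I_left 0 (u l) (- 1) = 0" "\<And>l. dxn I_left 1 (u l) (- 1) = of_real \<beta>2"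
      "\<And>l. dxn I_left 2 (u l) (- 1) = - of_real \<beta>1" "\<And>l. dxn I_left 3 (u l) (- 1) = 0"
    and "k < 4"
  shows "(\<lambda>(s::complex, x::real). cmod (dxn I_left k (u (s ^ 4)) x
            - (of_real \<beta>2 * of_real a1 / (2 * s) * dxn I_left k (\<lambda>y::real. sin (s * of_real (y + 1) / of_real a1)) x
               + of_real \<beta>2 * of_real a1 / (4 * s)
                 * dxn I_left k (\<lambda>y::real. exp (s * of_real (y + 1) / of_real a1) - exp (- (s * of_real (y + 1) / of_real a1))) x)))
         \<in> O[unif_at_infinity I_left](\<lambda>(s::complex, x::real). cmod s powi (int k - 2) * exp (cmod s * ((x + 1) / a1)))"
proof (rule bigo_uniformI [where R = "a1 * (1 + 2 * P)" and C = "(\<bar>\<beta>1\<bar> + 2 * P * (\<bar>\<beta>1\<bar> + \<bar>\<beta>2\<bar>)) * a1 ^ 2 / a1 ^ k"])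
  fix s :: complex and x :: real
  assume s: "a1 * (1 + 2 * P) \<le> cmod s" and x: "x \<in> I_left"
  let ?m = "of_real \<beta>2 * of_real a1 / (2 * s) * dxn I_left k (\<lambda>y::real. sin (s * of_real (y + 1) / of_real a1)) x
               + of_real \<beta>2 * of_real a1 / (4 * s)
                 * dxn I_left k (\<lambda>y::real. exp (s * of_real (y + 1) / of_real a1) - exp (- (s * of_real (y + 1) / of_real a1))) x"
  let ?C = "(\<bar>\<beta>1\<bar> + 2 * P * (\<bar>\<beta>1\<bar> + \<bar>\<beta>2\<bar>)) * a1 ^ 2 / a1 ^ k"
  define \<tau> where "\<tau> = s / of_real a1"
  define e where "e = exp (cmod s * ((x + 1) / a1))"
  define B where "B = (\<lambda>j. dxn I_left j (u (s ^ 4)) (- 1))"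
  have T: "cmod \<tau> = cmod s / a1"
    using \<open>0 < a1\<close> by (simp add: \<tau>_def norm_divide)
  have one: "1 \<le> cmod \<tau>" and large: "2 * P \<le> cmod \<tau> ^ 3"
    unfolding T by (rule large_parameter [OF \<open>0 < a1\<close> \<open>0 \<le> P\<close> s])+
  then have nz: "\<tau> \<noteq> 0" "s \<noteq> 0" "a1 \<noteq> 0" "a1 ^ 4 \<noteq> 0"
    using \<open>0 < a1\<close> by (auto simp: \<tau>_def)
  have B_vals: "B 0 = 0" "B 1 = of_real \<beta>2" "B 2 = - of_real \<beta>1" "B 3 = 0"
    unfolding B_def by (fact init)+
  have lim: "(dxn I_left j (u (s ^ 4)) \<longlongrightarrow> B j) (at_right (- 1))" if "j < 4" for j
    unfolding B_def
    by (rule solves_on_dxn_tendsto_start [OF unit_interval_at_I_left sol a \<open>a1 ^ 4 \<noteq> 0\<close> _ that]) auto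
  let ?U = "\<tau> ^ k / \<tau> ^ 3 * unperturbed \<tau> B k (\<tau> * of_real (x - (- 1)))"
  let ?K = "\<tau> ^ k / \<tau> ^ 2 * (of_real \<beta>1 * krylov (k + 2) (\<tau> * of_real (x + 1)))"
  have arg: "\<tau> * of_real (x - (- 1)) = \<tau> * of_real (x + 1)"
    by simp
  have "?U - ?m = - ?K"
    unfolding left_main_term [OF x \<open>a1 \<noteq> 0\<close> \<open>s \<noteq> 0\<close>] \<tau>_def [symmetric] arg unperturbed_expand B_vals
    using \<open>\<tau> \<noteq> 0\<close> by (simp add: field_simps eval_nat_numeral)
  then have "dxn I_left k (u (s ^ 4)) x - ?m = (dxn I_left k (u (s ^ 4)) x - ?U) + - ?K"
    by (simp add: algebra_simps)
  moreover have "cmod (dxn I_left k (u (s ^ 4)) x - ?U) \<le> cmod \<tau> ^ k / cmod \<tau> ^ 2 * (2 * P * (\<bar>\<beta>1\<bar> + \<bar>\<beta>2\<bar>) * e)"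
  proof -
    have "data_size (cmod \<tau>) B = cmod \<tau> ^ 2 * \<bar>\<beta>2\<bar> + cmod \<tau> ^ 1 * \<bar>\<beta>1\<bar>"
      by (simp only: data_size_expand B_vals) simp
    \<comment> \<open>Four of the six powers gained below can be spent here: the remainder needs only two.\<close>
    also have "\<dots> \<le> cmod \<tau> ^ 4 * \<bar>\<beta>2\<bar> + cmod \<tau> ^ 4 * \<bar>\<beta>1\<bar>"
      by (intro add_mono mult_right_mono power_increasing one) auto
    finally have size: "data_size (cmod \<tau>) B \<le> (\<bar>\<beta>1\<bar> + \<bar>\<beta>2\<bar>) * cmod \<tau> ^ 4"
      by (simp add: algebra_simps)
    have "cmod (dxn I_left k (u (s ^ 4)) x - ?U) \<le> 2 * P * data_size (cmod \<tau>) B * (cmod \<tau> ^ k * e) / cmod \<tau> ^ 6"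
      using solution_asymptotics [OF unit_interval_at_I_left sol a \<open>a1 \<noteq> 0\<close> q \<open>0 \<le> P\<close> lim \<tau>_def \<open>\<tau> \<noteq> 0\<close> large x \<open>k < 4\<close>]
      by (simp add: e_def T)
    also have "\<dots> \<le> 2 * P * ((\<bar>\<beta>1\<bar> + \<bar>\<beta>2\<bar>) * cmod \<tau> ^ 4) * (cmod \<tau> ^ k * e) / cmod \<tau> ^ 6"
      by (intro divide_right_mono mult_right_mono mult_left_mono size) (use \<open>0 \<le> P\<close> in \<open>auto simp: e_def\<close>)
    also have "\<dots> = cmod \<tau> ^ k / cmod \<tau> ^ 2 * (2 * P * (\<bar>\<beta>1\<bar> + \<bar>\<beta>2\<bar>) * e)"
      using \<open>\<tau> \<noteq> 0\<close> by (simp add: field_simps flip: power_add)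
    finally show ?thesis .
  qed
  moreover have "cmod (- ?K) \<le> cmod \<tau> ^ k / cmod \<tau> ^ 2 * (\<bar>\<beta>1\<bar> * e)"
  proof -
    have "cmod (krylov (k + 2) (\<tau> * of_real (x + 1))) \<le> e"
      using norm_krylov_le [of "k + 2" "\<tau> * of_real (x + 1)"] x by (simp add: norm_mult e_def T del: of_real_add)
    then have "\<bar>\<beta>1\<bar> * cmod (krylov (k + 2) (\<tau> * of_real (x + 1))) \<le> \<bar>\<beta>1\<bar> * e"
      by (rule mult_left_mono) simp
    then show ?thesis
      unfolding norm_minus_cancel norm_mult norm_divide norm_power norm_of_real
      by (rule mult_left_mono) simp
  qed
  ultimately have "cmod (dxn I_left k (u (s ^ 4)) x - ?m)
      \<le> cmod \<tau> ^ k / cmod \<tau> ^ 2 * (2 * P * (\<bar>\<beta>1\<bar> + \<bar>\<beta>2\<bar>) * e) + cmod \<tau> ^ k / cmod \<tau> ^ 2 * (\<bar>\<beta>1\<bar> * e)"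
    by (simp only: norm_triangle_le add_mono)
  then have "cmod s ^ 2 * cmod (dxn I_left k (u (s ^ 4)) x - ?m)
      \<le> cmod s ^ 2 * (cmod \<tau> ^ k / cmod \<tau> ^ 2 * (2 * P * (\<bar>\<beta>1\<bar> + \<bar>\<beta>2\<bar>) * e) + cmod \<tau> ^ k / cmod \<tau> ^ 2 * (\<bar>\<beta>1\<bar> * e))"
    by (rule mult_left_mono) simp
  also have "\<dots> = ?C * (cmod s ^ k * e)"
    using nz by (simp add: T power_divide field_simps)
  finally show "cmod (dxn I_left k (u (s ^ 4)) x - ?m) \<le> ?C * (cmod s powi (int k - 2) * exp (cmod s * ((x + 1) / a1)))"
    using le_power_int_diff [of "cmod s" 2] \<open>s \<noteq> 0\<close> by (simp only: e_def zero_less_norm_iff of_nat_numeral not_False_eq_True)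
qed

theorem lemma4p2:
  fixes a1 a2 \<beta>1 \<beta>2 \<delta>1 \<delta>2 :: real
    and q :: "real \<Rightarrow> real"
    and \<phi>11 \<phi>12 \<phi>21 \<phi>22 :: "complex \<Rightarrow> real \<Rightarrow> complex"
  assumes "a1 > 0" and "a2 > 0"
    and "continuous_on (I_left \<union> I_right) q"
    and "\<exists>c. (q \<longlongrightarrow> c) (at_left 0)" and "\<exists>c. (q \<longlongrightarrow> c) (at_right 0)"
    and "\<bar>\<beta>1\<bar> + \<bar>\<beta>2\<bar> \<noteq> 0" and "\<bar>\<delta>1\<bar> + \<bar>\<delta>2\<bar> \<noteq> 0"
    and "\<And>l. solves_on I_left (a_coeff a1 a2) q l (\<phi>11 l)"
    and "\<And>l. dxn I_left 0 (\<phi>11 l) (-1) = 0"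
    and "\<And>l. dxn I_left 1 (\<phi>11 l) (-1) = 0"
    and "\<And>l. dxn I_left 2 (\<phi>11 l) (-1) = 0"
    and "\<And>l. dxn I_left 3 (\<phi>11 l) (-1) = -1"
    and "\<And>l. solves_on I_left (a_coeff a1 a2) q l (\<phi>21 l)"
    and "\<And>l. dxn I_left 0 (\<phi>21 l) (-1) = 0"
    and "\<And>l. dxn I_left 1 (\<phi>21 l) (-1) = of_real \<beta>2"
    and "\<And>l. dxn I_left 2 (\<phi>21 l) (-1) = - of_real \<beta>1"
    and "\<And>l. dxn I_left 3 (\<phi>21 l) (-1) = 0"
    and "\<And>l. solves_on I_right (a_coeff a1 a2) q l (\<phi>12 l)"
    and "\<And>l. transmission \<delta>1 \<delta>2 l (\<phi>11 l) (\<phi>12 l)"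
    and "\<And>l. solves_on I_right (a_coeff a1 a2) q l (\<phi>22 l)"
    and "\<And>l. transmission \<delta>1 \<delta>2 l (\<phi>21 l) (\<phi>22 l)"
  shows "\<forall>k\<in>{0, 1, 2, 3::nat}.
       (\<lambda>(s::complex, x::real). cmod (dxn I_left k (\<phi>11 (s ^ 4)) x))
         \<in> O[unif_at_infinity I_left](\<lambda>(s::complex, x::real). cmod s powi (int k - 1) * exp (cmod s * ((x + 1) / a1)))
     \<and>
       (\<lambda>(s::complex, x::real). cmod (dxn I_right k (\<phi>12 (s ^ 4)) x
            - (of_real a2 ^ 2 * s ^ 2 * of_real \<delta>1 * left_value 1 (\<phi>11 (s ^ 4)) / 2
                 * dxn I_right k (\<lambda>y::real. cos (s * of_real y / of_real a2)) x
               + of_real a2 ^ 3 * s * of_real \<delta>2 * left_value 0 (\<phi>11 (s ^ 4)) / 2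
                 * dxn I_right k (\<lambda>y::real. sin (s * of_real y / of_real a2)) x
               - of_real a2 ^ 2 * s ^ 2 * of_real \<delta>1 * left_value 1 (\<phi>11 (s ^ 4)) / 4
                 * dxn I_right k (\<lambda>y::real. exp (s * of_real y / of_real a2) + exp (- (s * of_real y / of_real a2))) x
               - of_real a2 ^ 3 * s * of_real \<delta>2 * left_value 0 (\<phi>11 (s ^ 4)) / 4
                 * dxn I_right k (\<lambda>y::real. exp (s * of_real y / of_real a2) - exp (- (s * of_real y / of_real a2))) x)))
         \<in> O[unif_at_infinity I_right](\<lambda>(s::complex, x::real). cmod s powi (int k) * exp (cmod s * ((a1 * x + a2) / (a1 * a2))))
     \<and>
       (\<lambda>(s::complex, x::real). cmod (dxn I_left k (\<phi>21 (s ^ 4)) x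
            - (of_real \<beta>2 * of_real a1 / (2 * s) * dxn I_left k (\<lambda>y::real. sin (s * of_real (y + 1) / of_real a1)) x
               + of_real \<beta>2 * of_real a1 / (4 * s)
                 * dxn I_left k (\<lambda>y::real. exp (s * of_real (y + 1) / of_real a1) - exp (- (s * of_real (y + 1) / of_real a1))) x)))
         \<in> O[unif_at_infinity I_left](\<lambda>(s::complex, x::real). cmod s powi (int k - 2) * exp (cmod s * ((x + 1) / a1)))
     \<and>
       (\<lambda>(s::complex, x::real). cmod (dxn I_right k (\<phi>22 (s ^ 4)) x
            - (of_real a2 ^ 2 * s ^ 2 * of_real \<delta>1 * left_value 1 (\<phi>21 (s ^ 4)) / 2
                 * dxn I_right k (\<lambda>y::real. cos (s * of_real y / of_real a2)) x
               + of_real a2 ^ 3 * s * of_real \<delta>2 * left_value 0 (\<phi>21 (s ^ 4)) / 2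
                 * dxn I_right k (\<lambda>y::real. sin (s * of_real y / of_real a2)) x
               - of_real a2 ^ 2 * s ^ 2 * of_real \<delta>1 * left_value 1 (\<phi>21 (s ^ 4)) / 4
                 * dxn I_right k (\<lambda>y::real. exp (s * of_real y / of_real a2) + exp (- (s * of_real y / of_real a2))) x
               - of_real a2 ^ 3 * s * of_real \<delta>2 * left_value 0 (\<phi>21 (s ^ 4)) / 4
                 * dxn I_right k (\<lambda>y::real. exp (s * of_real y / of_real a2) - exp (- (s * of_real y / of_real a2))) x)))
         \<in> O[unif_at_infinity I_right](\<lambda>(s::complex, x::real). cmod s powi (int k - 1) * exp (cmod s * ((a1 * x + a2) / (a1 * a2))))"
proof -
  note a1 = assms(1) and a2 = assms(2) and qc = assms(3) and q_left = assms(4) and q_right = assms(5)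
  note sol11 = assms(8) and init11 = assms(9-12) and sol21 = assms(13) and init21 = assms(14-17)
  note sol12 = assms(18) and trans12 = assms(19) and sol22 = assms(20) and trans22 = assms(21)
  have coeff: "a_coeff a1 a2 x = a1 ^ 4" if "x \<in> I_left" for x
    using that by (simp add: a_coeff_def)
  have coeff': "a_coeff a1 a2 x = a2 ^ 4" if "x \<in> I_right" for x
    using that by (simp add: a_coeff_def)
  obtain QL where "0 \<le> QL" and QL: "\<And>x. x \<in> I_left \<Longrightarrow> \<bar>q x\<bar> \<le> QL"
  proof -
    obtain c where c: "(q \<longlongrightarrow> c) (at_left 0)"
      using q_left by blast
    have "at (0::real) within I_left = at_left 0"
      by (rule at_within_nhd [of _ "{-1<..}"]) auto
    with c have lim: "(q \<longlongrightarrow> c) (at 0 within I_left)"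
      by (simp only:)
    have "insert 0 I_left = {-1..0::real}"
      by auto
    then have "compact (insert 0 I_left)"
      by (simp only: compact_Icc)
    moreover have "continuous_on I_left q"
      by (rule continuous_on_subset [OF qc]) auto
    ultimately show thesis
      using bounded_on_punctured_compact [OF _ _ lim] that by auto
  qed
  obtain QR where "0 \<le> QR" and QR: "\<And>x. x \<in> I_right \<Longrightarrow> \<bar>q x\<bar> \<le> QR"
  proof -
    obtain c where c: "(q \<longlongrightarrow> c) (at_right 0)"
      using q_right by blast
    have "at (0::real) within I_right = at_right 0"
      by (rule at_within_nhd [of _ "{..<1}"]) auto
    with c have lim: "(q \<longlongrightarrow> c) (at 0 within I_right)"
      by (simp only:)
    have "insert 0 I_right = {0..1::real}"
      by auto
    then have "compact (insert 0 I_right)"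
      by (simp only: compact_Icc)
    moreover have "continuous_on I_right q"
      by (rule continuous_on_subset [OF qc]) auto
    ultimately show thesis
      using bounded_on_punctured_compact [OF _ _ lim] that by auto
  qed
  define P where "P = QL / a1 ^ 4"
  have P: "0 \<le> P"
    using \<open>0 \<le> QL\<close> by (simp add: P_def)
  have qP: "\<bar>q x\<bar> \<le> a1 ^ 4 * P" if "x \<in> I_left" for x
    using QL [OF that] a1 by (simp add: P_def)
  let ?R = "a1 * (1 + 2 * P)"
  have size11: "data_size (cmod s / a1) (\<lambda>j. dxn I_left j (\<phi>11 (s ^ 4)) (- 1)) \<le> 1 * (cmod s / a1) ^ 2"
    if "1 \<le> cmod s / a1" for s
  proof -
    have "data_size (cmod s / a1) (\<lambda>j. dxn I_left j (\<phi>11 (s ^ 4)) (- 1)) = 1"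
      unfolding data_size_expand init11 by simp
    then show ?thesis
      using one_le_power [OF that, of 2] by simp
  qed
  have size21: "data_size (cmod s / a1) (\<lambda>j. dxn I_left j (\<phi>21 (s ^ 4)) (- 1)) \<le> (\<bar>\<beta>1\<bar> + \<bar>\<beta>2\<bar>) * (cmod s / a1) ^ 2"
    if "1 \<le> cmod s / a1" for s
  proof -
    let ?T = "cmod s / a1"
    have "data_size ?T (\<lambda>j. dxn I_left j (\<phi>21 (s ^ 4)) (- 1)) = ?T ^ 2 * \<bar>\<beta>2\<bar> + ?T ^ 1 * \<bar>\<beta>1\<bar>"
      unfolding data_size_expand init21 by simp
    also have "\<dots> \<le> ?T ^ 2 * \<bar>\<beta>2\<bar> + ?T ^ 2 * \<bar>\<beta>1\<bar>"
      by (intro add_mono mult_right_mono power_increasing that) auto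
    finally show ?thesis
      by (simp add: algebra_simps)
  qed
  have one: "1 \<le> cmod s / a1" if "?R \<le> cmod s" for s :: complex
    by (rule large_parameter(1) [OF a1 P that])
  have values11: "cmod s * cmod (left_value j (\<phi>11 (s ^ 4))) \<le> 2 * 1 * a1 / a1 ^ j * (cmod s ^ j * exp (cmod s / a1))"
    if "j < 4" "?R \<le> cmod s" for j s
    by (rule left_growth(2) [OF sol11 coeff a1 qP P that(2) size11 [OF one [OF that(2)]] that(1)])
  have values21: "cmod s * cmod (left_value j (\<phi>21 (s ^ 4)))
      \<le> 2 * (\<bar>\<beta>1\<bar> + \<bar>\<beta>2\<bar>) * a1 / a1 ^ j * (cmod s ^ j * exp (cmod s / a1))"
    if "j < 4" "?R \<le> cmod s" for j s
    by (rule left_growth(2) [OF sol21 coeff a1 qP P that(2) size21 [OF one [OF that(2)]] that(1)])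
  have weaken: "(\<lambda>(s::complex, x::real). cmod s powi (int k - 1) * exp (cmod s * ((a1 * x + a2) / (a1 * a2))))
      \<in> O[unif_at_infinity I_right](\<lambda>(s, x). cmod s powi (int k) * exp (cmod s * ((a1 * x + a2) / (a1 * a2))))" for k
    by (rule power_int_mono_bigo) simp
  show ?thesis
  proof (rule ballI, goal_cases)
    case (1 k)
    then have k: "k < 4"
      by auto
    show ?case
      by (intro conjI
          left_growth_bigo [OF sol11 coeff a1 qP P size11 k]
          landau_o.big_trans [OF right_remainder_bigo [OF sol12 coeff' a1 a2 QR \<open>0 \<le> QR\<close> trans12 values11 _ k] weaken]
          left_leading_term_bigo [OF sol21 coeff a1 qP P init21 k]
          right_remainder_bigo [OF sol22 coeff' a1 a2 QR \<open>0 \<le> QR\<close> trans22 values21 _ k])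
        (use a1 in auto)
  qed
qed

end
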